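(* For all integers $k\ge1$ and $n\ge0$, $$e_4(5^kn+\delta_{5,k})\equiv0\pmod{5^k}.$$
   Context: $q=e^{2\pi i\tau}$, $(q;q)_\infty=\prod_{n\ge1}(1-q^n)$, $E_4(\tau)=1+240\sum_{n\ge1}\sigma_3(n)q^n$ with $\sigma_3(n)=\sum_{d\mid n}d^3$. The numbers $e_4(n)$ are defined by $\sum_{n\ge0}e_4(n)q^n=E_4(\tau)/(q;q)_\infty$. For a prime $\ell\ge5$ and $k\ge1$, $\delta_{\ell,k}$ denotes the integer with $0<\delta_{\ell,k}<\ell^k$ and $24\delta_{\ell,k}\equiv1\pmod{\ell^k}$. *)

theory Defs
  imports
    "HOL-Complex_Analysis.Complex_Analysis"
    "HOL-Number_Theory.Number_Theory"
    "HOL-Real_Asymp.Real_Asymp"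
begin

definition nome :: "complex \<Rightarrow> complex" where
  "nome \<tau> = exp (2 * of_real pi * \<i> * \<tau>)"

text \<open>
  The \<open>q\<close>-Pochhammer symbol \<open>(q;q)\<close> at infinity. As \<^const>\<open>prodinf\<close> and
  \<^const>\<open>suminf\<close> start at index 0, the index \<open>n \<ge> 1\<close> of the usual formulas is
  written as \<^term>\<open>Suc n\<close>, here and in the Eisenstein series below.
\<close>

definition euler_prod :: "complex \<Rightarrow> complex" where
  "euler_prod q = prodinf (\<lambda>n. 1 - q ^ Suc n)"

definition sigma3 :: "nat \<Rightarrow> nat" where
  "sigma3 n = (\<Sum>d | d dvd n. d ^ 3)"

definition E4 :: "complex \<Rightarrow> complex" where
  "E4 \<tau> = 1 + 240 * (\<Sum>n. of_nat (sigma3 (Suc n)) * nome \<tau> ^ Suc n)"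

definition e4_generating :: "(nat \<Rightarrow> int) \<Rightarrow> bool" where
  "e4_generating a \<longleftrightarrow>
     (\<forall>\<tau>. Im \<tau> > 0 \<longrightarrow>
        (\<lambda>n. of_int (a n) * nome \<tau> ^ n) sums (E4 \<tau> / euler_prod (nome \<tau>)))"

text \<open>
  The descriptions in \<open>e4\<close> and \<open>delta\<close> are proper: see \<open>ex1_e4_generating\<close>,
  \<open>sums_e4\<close> and \<open>delta_props\<close> below.
\<close>

definition e4 :: "nat \<Rightarrow> int" where
  "e4 = (THE a. e4_generating a)"

definition delta :: "nat \<Rightarrow> nat \<Rightarrow> nat" where
  "delta l k = (THE d. 0 < d \<and> d < l ^ k \<and> [24 * d = 1] (mod (l ^ k)))"


lemma euler_prod_props:
  assumes "norm q < 1"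
  shows "(\<lambda>n. 1 - q ^ Suc n) has_prod euler_prod q" and "euler_prod q \<noteq> 0"
proof -
  have "summable (\<lambda>n. norm q ^ Suc n)"
    using assms by (subst summable_Suc_iff) (auto intro: summable_geometric)
  hence "summable (\<lambda>n. norm ((1 - q ^ Suc n) - 1))"
    by (simp add: norm_mult norm_power)
  hence "convergent_prod (\<lambda>n. 1 - q ^ Suc n)"
    by (intro abs_convergent_prod_imp_convergent_prod summable_imp_abs_convergent_prod)
  thus *: "(\<lambda>n. 1 - q ^ Suc n) has_prod euler_prod q"
    by (simp add: convergent_prod_has_prod_iff euler_prod_def)
  have "q ^ Suc n \<noteq> 1" for n
  proof
    assume "q ^ Suc n = 1"
    hence "norm q ^ Suc n = 1" by (metis norm_one norm_power)
    moreover have "norm q ^ Suc n < 1"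
      using power_le_one[of "norm q" n] mult_left_le[of "norm q ^ n" "norm q"] assms by simp
    ultimately show False by simp
  qed
  hence "0 \<notin> range (\<lambda>n. 1 - q ^ Suc n)"
    by auto
  thus "euler_prod q \<noteq> 0"
    using has_prod_eq_0_iff[OF *] by simp
qed

lemma euler_prod_uniform_limit:
  assumes "0 \<le> r" "r < 1"
  shows "uniform_limit (cball 0 r) (\<lambda>N q. \<Prod>n<N. 1 - q ^ Suc n) euler_prod sequentially"
proof -
  have "uniformly_convergent_on (cball 0 r) (\<lambda>N q::complex. \<Prod>n<N. 1 - q ^ Suc n)"
  proof (rule uniformly_convergent_on_prod')
    show "uniformly_convergent_on (cball 0 r) (\<lambda>N q::complex. \<Sum>n<N. norm (1 - q ^ Suc n - 1))"
    proof (rule Weierstrass_m_test')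
      fix n and q :: complex assume "q \<in> cball 0 r"
      hence q: "norm q \<le> r" by auto
      show "norm (norm (1 - q ^ Suc n - 1)) \<le> r ^ Suc n"
        using power_mono[OF q, of "Suc n"] by (simp add: norm_mult norm_power)
    next
      show "summable (\<lambda>n. r ^ Suc n)"
        using assms by (subst summable_Suc_iff) (auto intro: summable_geometric)
    qed
  qed (auto intro!: continuous_intros)
  then obtain L where L: "uniform_limit (cball 0 r) (\<lambda>N q::complex. \<Prod>n<N. 1 - q ^ Suc n) L sequentially"
    by (auto simp: uniformly_convergent_on_def)
  have "L q = euler_prod q" if "q \<in> cball 0 r" for q
  proof -
    have "(\<lambda>N. \<Prod>n<N. 1 - q ^ Suc n) \<longlonglongrightarrow> L q"
      using tendsto_uniform_limitI[OF L that] .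
    moreover have "(\<lambda>N. \<Prod>n<N. 1 - q ^ Suc n) \<longlonglongrightarrow> euler_prod q"
      using has_prod_imp_tendsto'[OF euler_prod_props(1)[of q]] that assms by auto
    ultimately show ?thesis by (rule LIMSEQ_unique)
  qed
  thus ?thesis
    using uniform_limit_cong'[OF refl, THEN iffD1, OF _ L] by simp
qed

lemma euler_prod_holomorphic: "euler_prod holomorphic_on ball 0 1"
proof (rule holomorphic_uniform_sequence)
  fix x :: complex assume x: "x \<in> ball 0 1"
  define d where "d = (1 - norm x) / 2"
  have d: "d > 0" "norm x + d < 1" using x by (auto simp: d_def field_simps)
  have sub: "cball x d \<subseteq> cball 0 (norm x + d)"
  proof
    fix y assume "y \<in> cball x d"
    hence "norm (y - x) \<le> d" by (simp add: dist_norm norm_minus_commute)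
    thus "y \<in> cball 0 (norm x + d)"
      using norm_triangle_ineq[of x "y - x"] by simp
  qed
  have "uniform_limit (cball x d) (\<lambda>N q. \<Prod>n<N. 1 - q ^ Suc n) euler_prod sequentially"
    using uniform_limit_on_subset[OF euler_prod_uniform_limit[of "norm x + d"] sub] d by simp
  moreover have "cball x d \<subseteq> ball 0 1" using sub d by (auto simp: subset_iff)
  ultimately show "\<exists>d>0. cball x d \<subseteq> ball 0 1 \<and> 
      uniform_limit (cball x d) (\<lambda>N q. \<Prod>n<N. 1 - q ^ Suc n) euler_prod sequentially"
    using d by blast
qed (auto intro!: holomorphic_intros)

lemma Ints_fps_mult:
  fixes F G :: "complex fps"
  assumes "\<And>n. fps_nth F n \<in> \<int>" "\<And>n. fps_nth G n \<in> \<int>"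
  shows "fps_nth (F * G) n \<in> \<int>"
  unfolding fps_mult_nth using assms by (intro Ints_sum Ints_mult)

lemma Ints_fps_inverse:
  fixes F :: "complex fps"
  assumes "\<And>n. fps_nth F n \<in> \<int>" "fps_nth F 0 = 1"
  shows "fps_nth (inverse F) n \<in> \<int>"
proof (induction n rule: less_induct)
  case (less n)
  show ?case
  proof (cases n)
    case (Suc m)
    have "(\<Sum>i=0..n. fps_nth F i * fps_nth (inverse F) (n - i)) = fps_nth (F * inverse F) n"
      by (simp add: fps_mult_nth)
    also have "\<dots> = 0"
      using assms(2) Suc by (subst inverse_mult_eq_1') auto
    finally have "fps_nth (inverse F) n = - (\<Sum>i=1..n. fps_nth F i * fps_nth (inverse F) (n - i))"
      using assms(2) by (simp add: sum.atLeast_Suc_atMost add_eq_0_iff)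
    also have "\<dots> \<in> \<int>"
      using assms less by (intro Ints_minus Ints_sum Ints_mult) auto
    finally show ?thesis .
  qed (use assms in auto)
qed

lemma euler_prod_expansion:
  obtains F where "euler_prod has_fps_expansion F" "\<And>n. fps_nth F n \<in> \<int>" "fps_nth F 0 = 1"
proof
  let ?F = "fps_expansion euler_prod 0"
  show F: "euler_prod has_fps_expansion ?F"
    by (rule has_fps_expansion_fps_expansion[OF _ _ euler_prod_holomorphic]) auto
  let ?P = "\<lambda>N (q::complex). \<Prod>n<N. 1 - q ^ Suc n"
  let ?G = "\<lambda>N. \<Prod>n<N. (1 - fps_X ^ Suc n :: complex fps)"
  have G: "?P N has_fps_expansion ?G N" for N
    by (intro fps_expansion_intros)
  have IG: "fps_nth (?G N) n \<in> \<int>" for N n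
  proof (induction N arbitrary: n)
    case (Suc N)
    have "fps_nth (?G N * (1 - fps_X ^ Suc N)) n \<in> \<int>"
      using Suc.IH by (rule Ints_fps_mult) (auto simp del: power_Suc)
    thus ?case by simp
  qed auto
  show "fps_nth ?F n \<in> \<int>" for n
  proof -
    have ul: "uniform_limit (ball 0 (1/2)) ?P euler_prod sequentially"
      using euler_prod_uniform_limit[of "1/2"] by (rule uniform_limit_on_subset) auto
    have "(\<lambda>N. (deriv ^^ n) (?P N) 0) \<longlonglongrightarrow> (deriv ^^ n) euler_prod 0"
      by (rule higher_deriv_complex_uniform_limit[OF ul])
         (auto intro!: always_eventually holomorphic_intros)
    hence "(\<lambda>N. (deriv ^^ n) (?P N) 0 / fact n) \<longlonglongrightarrow> (deriv ^^ n) euler_prod 0 / fact n"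
      by (intro tendsto_intros) auto
    hence "(\<lambda>N. fps_nth (?G N) n) \<longlonglongrightarrow> fps_nth ?F n"
      by (simp only: fps_nth_fps_expansion[OF F] fps_nth_fps_expansion[OF G])
    thus ?thesis
      by (rule closed_sequentially[OF closed_Ints, rotated]) (use IG in auto)
  qed
  have "(\<lambda>n. 1 - 0 ^ Suc n :: complex) has_prod euler_prod 0"
    by (rule euler_prod_props) auto
  hence "euler_prod 0 = 1"
    by (simp add: euler_prod_def)
  thus "fps_nth ?F 0 = 1"
    by (simp add: fps_expansion_def)
qed

lemma sigma3_le: "sigma3 (Suc n) \<le> Suc n ^ 4"
proof -
  have "d \<in> {1..Suc n}" if "d dvd Suc n" for d
    using dvd_imp_le[OF that] that by (cases d) auto
  hence "sigma3 (Suc n) \<le> (\<Sum>d\<in>{1..Suc n}. d ^ 3)"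
    unfolding sigma3_def by (intro sum_mono2) auto
  also have "\<dots> \<le> (\<Sum>d\<in>{1..Suc n}. Suc n ^ 3)"
    by (intro sum_mono power_mono) auto
  also have "\<dots> = Suc n ^ 4"
    by (simp add: eval_nat_numeral)
  finally show ?thesis .
qed

text \<open>The \<open>q\<close>-expansion of \<^const>\<open>E4\<close>; only used in the proof that \<^const>\<open>e4\<close> is well-defined.\<close>

definition E4_fps :: "complex fps" where
  "E4_fps = Abs_fps (\<lambda>n. if n = 0 then 1 else 240 * of_nat (sigma3 n))"

lemma E4_fps_conv_radius: "fps_conv_radius E4_fps \<ge> 1"
  unfolding fps_conv_radius_def
proof (rule conv_radius_geI_ex')
  fix r :: real assume r: "0 < r" "ereal r < 1"
  have "conv_radius (\<lambda>n. of_nat (Suc n) ^ 4 :: real) = 1"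
  proof (rule conv_radius_ratio_limit[where c = 1])
    show "(\<lambda>n. norm (of_nat (Suc n) ^ 4 :: real) / norm (of_nat (Suc (Suc n)) ^ 4 :: real)) \<longlonglongrightarrow> 1"
      unfolding real_norm_def abs_of_nonneg[OF zero_le_power[OF of_nat_0_le_iff]] by real_asymp
  qed (auto simp: one_ereal_def)
  hence "summable (\<lambda>n. of_nat (Suc n) ^ 4 * r ^ n)"
    using r by (intro summable_in_conv_radius) auto
  hence *: "summable (\<lambda>n. 240 * r * (of_nat (Suc n) ^ 4 * r ^ n))"
    by (rule summable_mult)
  have "summable (\<lambda>n. fps_nth E4_fps (Suc n) * of_real r ^ Suc n)"
  proof (rule summable_comparison_test'[OF *])
    fix n :: nat
    have "real (sigma3 (Suc n)) \<le> real (Suc n) ^ 4"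
      using sigma3_le[of n] by (metis of_nat_le_iff of_nat_power)
    thus "norm (fps_nth E4_fps (Suc n) * of_real r ^ Suc n) \<le> 240 * r * (of_nat (Suc n) ^ 4 * r ^ n)"
      using r by (simp add: E4_fps_def norm_mult norm_power mult_right_mono)
  qed
  thus "summable (\<lambda>n. fps_nth E4_fps n * of_real r ^ n)"
    by (subst (asm) summable_Suc_iff)
qed

lemma norm_nome: "norm (nome \<tau>) = exp (- 2 * pi * Im \<tau>)"
  by (simp add: nome_def)

lemma norm_nome_less_1: "Im \<tau> > 0 \<Longrightarrow> norm (nome \<tau>) < 1"
  by (simp add: norm_nome)

lemma nome_surj:
  assumes "q \<noteq> 0" "norm q < 1"
  obtains \<tau> where "Im \<tau> > 0" "nome \<tau> = q"
proof
  let ?\<tau> = "Ln q / (2 * of_real pi * \<i>)"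
  show *: "nome ?\<tau> = q" using assms by (simp add: nome_def)
  show "Im ?\<tau> > 0"
    using assms norm_nome[of ?\<tau>] unfolding * by (simp add: mult_less_0_iff zero_less_mult_iff)
qed

lemma E4_conv_eval_fps:
  assumes "Im \<tau> > 0"
  shows "E4 \<tau> = eval_fps E4_fps (nome \<tau>)"
proof -
  let ?q = "nome \<tau>"
  have "ereal (norm ?q) < 1" using norm_nome_less_1[OF assms] by simp
  hence s: "summable (\<lambda>n. fps_nth E4_fps n * ?q ^ n)"
    using E4_fps_conv_radius by (intro summable_fps) (rule less_le_trans)
  have "summable (\<lambda>n. 240 * (of_nat (sigma3 (Suc n)) * ?q ^ Suc n))"
    using iffD2[OF summable_Suc_iff s] by (simp add: E4_fps_def algebra_simps)
  hence s': "summable (\<lambda>n. of_nat (sigma3 (Suc n)) * ?q ^ Suc n)"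
    by (subst (asm) summable_cmult_iff) auto
  have "eval_fps E4_fps ?q = (\<Sum>n. fps_nth E4_fps (Suc n) * ?q ^ Suc n) + 1"
    using suminf_split_head[OF s] by (simp add: eval_fps_def E4_fps_def)
  also have "(\<Sum>n. fps_nth E4_fps (Suc n) * ?q ^ Suc n) =
               (\<Sum>n. 240 * (of_nat (sigma3 (Suc n)) * ?q ^ Suc n))"
    by (simp add: E4_fps_def algebra_simps)
  also have "\<dots> = 240 * (\<Sum>n. of_nat (sigma3 (Suc n)) * ?q ^ Suc n)"
    by (rule suminf_mult[OF s'])
  finally show ?thesis by (simp add: E4_def)
qed

lemma e4_exists:
  "\<exists>a :: nat \<Rightarrow> int. \<forall>\<tau>. Im \<tau> > 0 \<longrightarrow>
     (\<lambda>n. of_int (a n) * nome \<tau> ^ n) sums (E4 \<tau> / euler_prod (nome \<tau>))"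
proof -
  obtain F where F: "euler_prod has_fps_expansion F" "\<And>n. fps_nth F n \<in> \<int>" "fps_nth F 0 = 1"
    using euler_prod_expansion by blast
  let ?f = "\<lambda>q. eval_fps E4_fps q * inverse (euler_prod q)"
  let ?H = "E4_fps * inverse F"
  have 1: "?f has_fps_expansion ?H"
    using F(3) less_le_trans[OF _ E4_fps_conv_radius, of 0]
    by (intro has_fps_expansion_mult has_fps_expansion_inverse F eval_fps_has_fps_expansion) auto
  have "fps_nth E4_fps n \<in> \<int>" for n
    by (auto simp: E4_fps_def)
  hence "fps_nth ?H n \<in> \<int>" for n
    using Ints_fps_inverse[OF F(2,3)] by (rule Ints_fps_mult)
  hence "\<exists>z. fps_nth ?H n = of_int z" for n
    by (meson Ints_cases)
  then obtain a where a: "fps_nth ?H n = of_int (a n)" for n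
    by metis
  have "ereal (norm q) < fps_conv_radius E4_fps" if "norm q < 1" for q :: complex
    using that by (intro less_le_trans[OF _ E4_fps_conv_radius]) simp
  hence holo: "?f holomorphic_on ball 0 1"
    using euler_prod_props(2) by (intro holomorphic_intros euler_prod_holomorphic) auto
  have "(\<lambda>n. of_int (a n) * nome \<tau> ^ n) sums (E4 \<tau> / euler_prod (nome \<tau>))" if "Im \<tau> > 0" for \<tau>
  proof -
    have "(\<lambda>n. (deriv ^^ n) ?f 0 / fact n * (nome \<tau> - 0) ^ n) sums ?f (nome \<tau>)"
      by (rule holomorphic_power_series[OF holo]) (use norm_nome_less_1[OF that] in auto)
    thus ?thesis
      unfolding fps_nth_fps_expansion[OF 1, symmetric] a
      by (simp add: E4_conv_eval_fps[OF that] field_simps)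
  qed
  thus ?thesis by blast
qed

lemma e4_unique:
  fixes a b :: "nat \<Rightarrow> int"
  assumes a: "\<And>\<tau>. Im \<tau> > 0 \<Longrightarrow>
     (\<lambda>n. of_int (a n) * nome \<tau> ^ n) sums (E4 \<tau> / euler_prod (nome \<tau>))"
  assumes b: "\<And>\<tau>. Im \<tau> > 0 \<Longrightarrow>
     (\<lambda>n. of_int (b n) * nome \<tau> ^ n) sums (E4 \<tau> / euler_prod (nome \<tau>))"
  shows "a = b"
proof -
  have sums_a: "(\<lambda>n. of_int (a n) * q ^ n) sums (eval_fps E4_fps q / euler_prod q)"
    and sums_b: "(\<lambda>n. of_int (b n) * q ^ n) sums (eval_fps E4_fps q / euler_prod q)"
    if q: "q \<noteq> 0" "norm q < 1" for q :: complex
  proof -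
    from q obtain \<tau> where \<tau>: "Im \<tau> > 0" "nome \<tau> = q" by (rule nome_surj)
    show "(\<lambda>n. of_int (a n) * q ^ n) sums (eval_fps E4_fps q / euler_prod q)"
      using a[OF \<tau>(1)] by (simp add: E4_conv_eval_fps \<tau>)
    show "(\<lambda>n. of_int (b n) * q ^ n) sums (eval_fps E4_fps q / euler_prod q)"
      using b[OF \<tau>(1)] by (simp add: E4_conv_eval_fps \<tau>)
  qed
  let ?A = "Abs_fps (\<lambda>n. of_int (a n) :: complex)"
  let ?B = "Abs_fps (\<lambda>n. of_int (b n) :: complex)"
  have rad: "fps_conv_radius (Abs_fps (\<lambda>n. of_int (c n) :: complex)) > 0"
    if "\<And>q. q \<noteq> 0 \<Longrightarrow> norm q < 1 \<Longrightarrow> summable (\<lambda>n. of_int (c n) * q ^ n :: complex)"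
    for c :: "nat \<Rightarrow> int"
  proof -
    have "conv_radius (\<lambda>n. of_int (c n) :: complex) \<ge> norm (1 / 2 :: complex)"
      by (rule conv_radius_geI) (rule that, auto)
    hence "conv_radius (\<lambda>n. of_int (c n) :: complex) \<ge> ereal (1 / 2)" by (simp add: norm_divide)
    moreover have "ereal (1 / 2) > 0" by simp
    ultimately have "conv_radius (\<lambda>n. of_int (c n) :: complex) > 0" by (rule less_le_trans[rotated])
    thus ?thesis by (simp add: fps_conv_radius_def)
  qed
  have "(of_int (a 0) :: complex) = of_int (b 0)"
  proof (rule tendsto_unique[OF at_neq_bot])
    show "((\<lambda>q. eval_fps E4_fps q / euler_prod q) \<longlongrightarrow> of_int (a 0)) (at 0)"
      by (rule powser_limit_0_strong[of 1 "\<lambda>n. of_int (a n)"]) (use sums_a in auto)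
    show "((\<lambda>q. eval_fps E4_fps q / euler_prod q) \<longlongrightarrow> of_int (b 0)) (at 0)"
      by (rule powser_limit_0_strong[of 1 "\<lambda>n. of_int (b n)"]) (use sums_b in auto)
  qed
  hence "eval_fps ?A q = eval_fps ?B q" if "q \<in> ball 0 1" for q
    using that sums_unique[OF sums_a[of q]] sums_unique[OF sums_b[of q]]
    by (cases "q = 0") (auto simp: eval_fps_at_0 eval_fps_def)
  hence "eventually (\<lambda>q. eval_fps ?A q = eval_fps ?B q) (nhds 0)"
    by (intro eventually_nhds_in_open[THEN eventually_mono, of "ball 0 1"]) auto
  hence "?A = ?B"
    by (intro eval_fps_eqD rad sums_summable[OF sums_a] sums_summable[OF sums_b])
  thus ?thesis by (auto simp: fps_eq_iff)
qed

lemma ex1_e4_generating: "\<exists>!a. e4_generating a"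
proof (rule ex_ex1I)
  show "\<exists>a. e4_generating a"
    unfolding e4_generating_def by (rule e4_exists)
next
  fix a b assume "e4_generating a" "e4_generating b"
  thus "a = b"
    by (intro e4_unique) (auto simp: e4_generating_def)
qed

lemma sums_e4:
  assumes "Im \<tau> > 0"
  shows "(\<lambda>n. of_int (e4 n) * nome \<tau> ^ n) sums (E4 \<tau> / euler_prod (nome \<tau>))"
proof -
  have "e4_generating e4"
    unfolding e4_def by (rule theI'[OF ex1_e4_generating])
  thus ?thesis using assms by (simp add: e4_generating_def)
qed

lemma delta_props:
  assumes "prime l" "l \<ge> 5" "k \<ge> 1"
  shows "0 < delta l k \<and> delta l k < l ^ k \<and> [24 * delta l k = 1] (mod (l ^ k))"
  unfolding delta_def
proof (rule theI')
  have "coprime l 24"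
  proof (rule prime_imp_coprime[OF assms(1)])
    show "\<not> l dvd 24"
    proof
      assume "l dvd 24"
      hence "l dvd 2 ^ 3 * 3" by simp
      hence "l dvd 2 ^ 3 \<or> l dvd 3" using assms(1) by (simp only: prime_dvd_mult_iff)
      hence "l dvd 2 \<or> l dvd 3" using assms(1) prime_dvd_power[of l 2 3] by blast
      thus False using assms(2) by (auto dest: dvd_imp_le)
    qed
  qed
  hence c: "coprime 24 (l ^ k)" by (simp add: coprime_commute)
  have "1 < l ^ k" using assms by (intro one_less_power) auto
  obtain x where x: "[24 * x = 1] (mod (l ^ k))"
    using cong_solve_coprime_nat[OF c] by auto
  define d where "d = x mod l ^ k"
  have "d < l ^ k" unfolding d_def using \<open>1 < l ^ k\<close> by (intro mod_less_divisor) linarith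
  moreover have "[24 * d = 1] (mod (l ^ k))"
    using x unfolding d_def cong_def by (simp add: mod_mult_right_eq)
  ultimately have d: "[24 * d = 1] (mod (l ^ k))" "d < l ^ k" by simp_all
  have "d \<noteq> 0"
  proof
    assume "d = 0"
    hence "[0 = 1] (mod (l ^ k))" using d(1) by simp
    thus False using \<open>1 < l ^ k\<close> by (simp only: cong_def mod_0 mod_less)
  qed
  show "\<exists>!d. 0 < d \<and> d < l ^ k \<and> [24 * d = 1] (mod (l ^ k))"
  proof (rule ex1I)
    show "0 < d \<and> d < l ^ k \<and> [24 * d = 1] (mod (l ^ k))" using d \<open>d \<noteq> 0\<close> by simp
  next
    fix e assume e: "0 < e \<and> e < l ^ k \<and> [24 * e = 1] (mod (l ^ k))"
    hence "[24 * e = 24 * d] (mod (l ^ k))" using d(1) by (simp only: cong_def)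
    hence "[e = d] (mod (l ^ k))" using c by (simp add: cong_mult_lcancel_nat)
    thus "e = d" using e d by (simp add: cong_def)
  qed
qed

end

(*
  Write V (dil) for the substitution q -> q^5 and U (sect) for the map sending the sum of a(n) q^n to
  the sum of a(5n) q^n. Put E = (q;q)_inf (euler), w = E^5 / V E (eta_quot), h = q (V E)^6 / E^6
  (hauptmodul) and Y = E / (q V V E) (eta_ratio), all as formal series.

  The pentagonal number theorem and Jacobi's formula for E^3 determine the 5-dissection of E, which
  gives Y = 1/r - 1 - r with r = q / (a unit in q^5).  Comparing logarithmic derivatives then yields
  Watson's modular equation V(1/h) = Y^5 + 5 Y^4 + 15 Y^3 + 25 Y^2 + 25 Y.

  The identity E_4 = w^2 (1 + 250 h + 3125 h^2) needs no theory of modular forms: the modular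
  equation and Ramanujan's formula E_4 = E_2^2 - 12 q dE_2/dq show that the difference D of both
  sides satisfies D = 25 V D, and a Laurent series with this property vanishes.  The same device
  (F = V F forces F to be constant) proves the quadratic relation between (5 V E_2 - E_2)/4, w and h
  that is needed on the way.

  Finally, the modular equation is a recurrence for U(Y^m), m in Z, and
  U(w^2 h^i Y^s) = w^2 h^(2-i) U(Y^(10-6i+s)).  Starting from E_4 / E, alternately multiplying by q and
  not before applying U, the generating functions of e_4(5^k n + delta) are, up to the factor E or V E,
  w^2 times an integer polynomial in h, without constant term, whose coefficient at h^j is divisible
  by 5^(k+j-1).
*)

theory Submission
  imports Defs
begin

text \<open>The mechanism is that \<open>hauptmodul\<close>, \<open>dil hauptmodul\<close> and
  \<open>eta_quot / dil eta_quot\<close> are all rational functions of the one series Y. A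
  comparison of F with V F thus becomes a polynomial identity in Y, and U is known on all w^2 h^i
  once it is known on the powers of Y. The exponent k+j-1 has to grow with j: a plain bound 5^k does
  not survive the induction, since U(w^2 h^4 / Y) = w^2 (h + higher powers of h) gains no factor 5.
  The first application of U stands apart. The summand w^2 of E_4 leads to U(Y^9), which the general
  bound for U(Y^m) does not cover; it is computed outright, and its contribution -90 h happens to be
  divisible by 5. The alternation has a simple source: E U(F) = U(V E F) and V E U(F) = U(V V E F).
  If E is already cleared, the extra q turns V V E / E into 1/Y; if V E is cleared, no power of Y
  appears.\<close>

unbundle fps_syntax
declare fls_X_power_int [simp del] fls_divide_X [simp del] fls_divide_X_power [simp del]

section \<open>Dissection operators on Laurent series\<close>

definition dil :: "'a::zero fls \<Rightarrow> 'a fls" where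
  "dil F = fls_compose_power F 5"

definition sect :: "'a::zero fls \<Rightarrow> 'a fls" where
  "sect F = Abs_fls (\<lambda>n. F $$ (5 * n))"

text \<open>The operator q d/dq: unlike \<open>fls_deriv\<close> it keeps exponents, so it commutes
  with \<open>dil\<close> up to the factor 5.\<close>

definition qderiv :: "'a::ring_1 fls \<Rightarrow> 'a fls" where
  "qderiv F = fls_X * fls_deriv F"

definition logder :: "'a::field fls \<Rightarrow> 'a fls" where
  "logder F = qderiv F / F"

lemma dil_nth: "dil F $$ n = (if 5 dvd n then F $$ (n div 5) else 0)"
  by (simp add: dil_def fls_nth_compose_power)

lemma dil_simps [simp]:
  fixes F G :: "'a::field_char_0 fls"
  shows "dil 0 = (0 :: 'a fls)" "dil 1 = (1 :: 'a fls)" "dil (F + G) = dil F + dil G"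
    "dil (F - G) = dil F - dil G" "dil (- F) = - dil F" "dil (F * G) = dil F * dil G"
    "dil (F ^ n) = dil F ^ n" "dil fls_X = (fls_X ^ 5 :: 'a fls)" "dil (fls_const c) = fls_const c"
  using fls_X_power_conv_shift_1[of 5, where ?'a='a]
  by (simp_all add: dil_def fls_X_power_conv_shift_1)

lemma dil_numeral [simp]: "dil (numeral n :: 'a::field_char_0 fls) = numeral n"
  by (metis dil_simps(9) fls_const_numeral)

lemma dil_of_int [simp]: "dil (of_int n :: 'a::field_char_0 fls) = of_int n"
  by (metis dil_simps(9) fls_of_int)

lemma dil_eq_iff [simp]: "dil F = dil G \<longleftrightarrow> F = G"
proof
  assume *: "dil F = dil G"
  show "F = G"
  proof (rule fls_eqI)
    fix n
    have "dil F $$ (5 * n) = dil G $$ (5 * n)" using * by simp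
    thus "F $$ n = G $$ n" by (simp add: dil_nth)
  qed
qed simp

lemma dil_eq_0_iff [simp]: "dil F = 0 \<longleftrightarrow> (F :: 'a::field_char_0 fls) = 0"
  using dil_eq_iff[of F 0] by simp

lemma dil_inverse [simp]: "dil (inverse F) = inverse (dil F :: 'a::field_char_0 fls)"
proof (cases "F = 0")
  case False
  have "dil (inverse F) * dil F = 1"
    using False by (simp flip: dil_simps(6))
  thus ?thesis using False by (simp add: field_simps)
qed simp

lemma dil_divide [simp]: "dil (F / G) = dil F / (dil G :: 'a::field_char_0 fls)"
  by (simp add: divide_inverse)

lemma dil_powi [simp]: "dil (F powi n) = dil (F :: 'a::field_char_0 fls) powi n"
  by (simp add: power_int_def)

lemma sect_nth [simp]: "sect F $$ n = F $$ (5 * n)"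
  unfolding sect_def
proof (rule nth_Abs_fls_lower_bound, safe)
  fix m assume "m < - \<bar>fls_subdegree F\<bar>"
  thus "F $$ (5 * m) = 0" by (intro fls_eq0_below_subdegree) auto
qed

lemma sect_add [simp]: "sect (F + G) = sect F + sect (G :: 'a::field_char_0 fls)"
  and sect_diff [simp]: "sect (F - G) = sect F - sect (G :: 'a::field_char_0 fls)"
  and sect_uminus [simp]: "sect (- F) = - sect (F :: 'a::field_char_0 fls)"
  and sect_0 [simp]: "sect 0 = (0 :: 'a fls)"
  by (simp_all add: fls_eq_iff)

lemma fls_mult_nth_bounds:
  fixes f g :: "'a::field_char_0 fls"
  assumes "\<And>i. i < a \<Longrightarrow> f $$ i = 0" "\<And>i. i < b \<Longrightarrow> g $$ i = 0"
  shows "(f * g) $$ n = (\<Sum>i=a..n-b. f $$ i * g $$ (n - i))"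
proof (cases "f = 0 \<or> g = 0")
  case False
  hence "a \<le> fls_subdegree f" "b \<le> fls_subdegree g"
    using assms nth_fls_subdegree_nonzero by (meson not_le)+
  thus ?thesis
    unfolding fls_times_nth(2) by (intro sum.mono_neutral_left) auto
qed auto

lemma sect_dil_mult: "sect (dil g * F) = g * sect (F :: 'a::field_char_0 fls)"
proof (rule fls_eqI)
  fix n
  define a where "a = fls_subdegree g"
  \<comment> \<open>Minus the absolute value, because \<open>F\<close> must vanish below
    \<open>5 * b\<close>; a positive subdegree itself would not do.\<close>
  define b where "b = - \<bar>fls_subdegree F\<bar>"
  have a: "g $$ i = 0" if "i < a" for i using that by (simp add: a_def)
  have b: "F $$ i = 0" if "i < 5 * b" for i
    using that by (intro fls_eq0_below_subdegree) (auto simp: b_def)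
  have "(dil g * F) $$ (5 * n) = (\<Sum>i=5*a..5*n-5*b. dil g $$ i * F $$ (5 * n - i))"
    by (intro fls_mult_nth_bounds b) (auto simp: dil_nth intro!: a)
  also have "\<dots> = (\<Sum>i\<in>(\<lambda>j. 5 * j) ` {a..n-b}. dil g $$ i * F $$ (5 * n - i))"
    by (intro sum.mono_neutral_right) (auto simp: dil_nth elim!: dvdE)
  also have "\<dots> = (\<Sum>j=a..n-b. g $$ j * sect F $$ (n - j))"
    by (subst sum.reindex) (auto simp: inj_on_def dil_nth algebra_simps)
  also have "\<dots> = (g * sect F) $$ n"
    by (intro fls_mult_nth_bounds[symmetric] a) (auto intro: b)
  finally show "sect (dil g * F) $$ n = (g * sect F) $$ n" by simp
qed

lemma sect_mult_dil: "sect (F * dil g) = sect (F :: 'a::field_char_0 fls) * g"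
  using sect_dil_mult[of g F] by (simp add: mult.commute)

lemma sect_dil [simp]: "sect (dil g) = g"
  by (simp add: fls_eq_iff dil_nth)

lemma sect_const_mult [simp]:
  "sect (numeral k * F) = numeral k * sect (F :: 'a::field_char_0 fls)"
  "sect (of_int i * F) = of_int i * sect (F :: 'a::field_char_0 fls)"
  using sect_dil_mult[of "numeral k" F] sect_dil_mult[of "of_int i" F] by simp_all

lemma sect_X_power: "\<not> 5 dvd k \<Longrightarrow> sect (fls_X ^ k :: 'a::field_char_0 fls) = 0"
  by (auto simp: fls_eq_iff) presburger

text \<open>Infinite descent: a nonzero coefficient at \<open>n\<close> forces 5 to divide
  \<open>n\<close> and a nonzero coefficient at \<open>n div 5\<close>, which is impossible for
  \<open>n \<noteq> 0\<close>. The constant term is left free if \<open>c = 1\<close> and is 0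
  otherwise.\<close>

lemma dil_fixed_imp_const:
  fixes F :: "'a::field_char_0 fls"
  assumes "F = fls_const c * dil F"
  shows "F = fls_const (F $$ 0)"
proof (rule fls_eqI)
  fix n
  have "F $$ n = 0" if "n \<noteq> 0" for n
    using that
  proof (induction "nat \<bar>n\<bar>" arbitrary: n rule: less_induct)
    case less
    have *: "F $$ n = c * dil F $$ n"
      by (subst assms) simp
    show ?case
    proof (cases "5 dvd n")
      case True
      then obtain m where m: "n = 5 * m" by blast
      have "F $$ m = 0" using less m by (intro less.hyps) auto
      thus ?thesis using * m by (simp add: dil_nth)
    qed (use * in \<open>simp add: dil_nth\<close>)
  qed
  thus "F $$ n = fls_const (F $$ 0) $$ n" by auto
qed

lemma qderiv_nth [simp]: "qderiv F $$ n = of_int n * F $$ n"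
  by (simp add: qderiv_def fls_X_times_conv_shift)

lemma qderiv_simps [simp]:
  fixes F G :: "'a::field_char_0 fls"
  shows "qderiv (F + G) = qderiv F + qderiv G" "qderiv (F - G) = qderiv F - qderiv G"
    "qderiv (- F) = - qderiv F" "qderiv (numeral k) = (0 :: 'a fls)" "qderiv 1 = (0 :: 'a fls)"
    "qderiv 0 = (0 :: 'a fls)" "qderiv (numeral k * F) = numeral k * qderiv F"
  by (simp_all add: qderiv_def algebra_simps)

lemma qderiv_mult: "qderiv (F * G) = qderiv F * G + F * qderiv (G :: 'a::field_char_0 fls)"
  by (simp add: qderiv_def algebra_simps)

lemma qderiv_X [simp]: "qderiv fls_X = (fls_X :: 'a::field_char_0 fls)"
  by (simp add: qderiv_def)

lemma qderiv_dil: "qderiv (dil F) = 5 * dil (qderiv (F :: 'a::field_char_0 fls))"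
proof (rule fls_eqI)
  fix n :: int
  have "(5 * dil (qderiv F)) $$ n = 5 * dil (qderiv F) $$ n"
    by (metis fls_const_numeral fls_mult_const_nth(1))
  thus "qderiv (dil F) $$ n = (5 * dil (qderiv F)) $$ n"
    by (auto simp: dil_nth elim!: dvdE)
qed

lemma qderiv_eq_0_imp_const: "qderiv F = 0 \<Longrightarrow> (F :: 'a::field_char_0 fls) = fls_const (F $$ 0)"
  by (simp add: qderiv_def flip: fls_deriv_eq_0_iff)

lemma logder_mult:
  "F \<noteq> 0 \<Longrightarrow> G \<noteq> 0 \<Longrightarrow> logder (F * G) = logder F + logder (G :: 'a::field_char_0 fls)"
  by (simp add: logder_def qderiv_mult field_simps)

lemma logder_power: 
  assumes "F \<noteq> 0"
  shows "logder (F ^ n) = of_nat n * logder (F :: 'a::field_char_0 fls)"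
proof (induction n)
  case (Suc n)
  thus ?case using assms by (simp add: logder_mult algebra_simps)
qed (simp add: logder_def)

lemma logder_divide:
  assumes "F \<noteq> 0" "G \<noteq> 0"
  shows "logder (F / G) = logder F - logder (G :: 'a::field_char_0 fls)"
  using logder_mult[of "F / G" G] assms by simp

lemma logder_X [simp]: "logder fls_X = (1 :: 'a::field_char_0 fls)"
  by (simp add: logder_def)

lemma logder_dil: "logder (dil F) = 5 * dil (logder (F :: 'a::field_char_0 fls))"
  by (simp add: logder_def qderiv_dil)

lemma qderiv_conv_logder: "F \<noteq> 0 \<Longrightarrow> qderiv F = F * logder (F :: 'a::field_char_0 fls)"
  by (simp add: logder_def)

section \<open>Order of vanishing\<close>

text \<open>This is F = O(q^N). Identities for infinite products are obtained by proving them modulo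
  every power of q.\<close>

definition vanish :: "int \<Rightarrow> 'a::zero fls \<Rightarrow> bool" where
  "vanish N F \<longleftrightarrow> (\<forall>n<N. F $$ n = 0)"

lemma vanish_mono: "vanish N F \<Longrightarrow> M \<le> N \<Longrightarrow> vanish M F"
  by (auto simp: vanish_def)

lemma vanish_0 [simp]: "vanish N 0"
  by (simp add: vanish_def)

lemma vanish_add: "vanish N F \<Longrightarrow> vanish N G \<Longrightarrow> vanish N (F + G :: 'a::field_char_0 fls)"
  and vanish_diff: "vanish N F \<Longrightarrow> vanish N G \<Longrightarrow> vanish N (F - G :: 'a::field_char_0 fls)"
  by (auto simp: vanish_def)

lemma vanish_sum:
  "(\<And>i. i \<in> A \<Longrightarrow> vanish N (F i)) \<Longrightarrow> vanish N (\<Sum>i\<in>A. F i :: 'a::field_char_0 fls)"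
  by (induction A rule: infinite_finite_induct) (auto intro: vanish_add)

lemma vanish_mult:
  fixes F G :: "'a::field_char_0 fls"
  assumes "vanish M F" "vanish N G"
  shows "vanish (M + N) (F * G)"
  unfolding vanish_def
proof safe
  fix n assume "n < M + N"
  thus "(F * G) $$ n = 0"
    using assms by (subst fls_mult_nth_bounds[of M _ N]) (auto simp: vanish_def)
qed

lemma vanish_X_power [simp]: "vanish (int k) (fls_X ^ k :: 'a::field_char_0 fls)"
  by (simp add: vanish_def)

lemma vanish_const [simp]: "vanish 0 (fls_const c)"
  by (simp add: vanish_def)

lemma vanish_of_nat [simp]:
  "vanish 0 (1 :: 'a::field_char_0 fls)" "vanish 0 (of_nat k :: 'a::field_char_0 fls)"
  "vanish 0 (numeral m :: 'a::field_char_0 fls)" "vanish 0 (of_int i :: 'a::field_char_0 fls)"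
  by (metis fls_const_1 vanish_const, metis fls_of_nat vanish_const, 
      metis fls_const_numeral vanish_const, metis fls_of_int vanish_const)

text \<open>The normalisation that fixes the constant to 1 whenever a series has been shown to be
  constant.\<close>

definition unit1 :: "'a::field_char_0 fls \<Rightarrow> bool" where
  "unit1 F \<longleftrightarrow> vanish 1 (F - 1)"

lemma unit1_iff: "unit1 F \<longleftrightarrow> (\<forall>n<0. F $$ n = 0) \<and> F $$ 0 = 1"
proof
  assume "unit1 F"
  hence *: "(F - 1) $$ n = 0" if "n < 1" for n using that by (auto simp: unit1_def vanish_def)
  show "(\<forall>n<0. F $$ n = 0) \<and> F $$ 0 = 1"
  proof (intro conjI allI impI)
    fix n :: int assume "n < 0"
    thus "F $$ n = 0" using *[of n] by simp
  qed (use *[of 0] in simp)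
next
  assume "(\<forall>n<0. F $$ n = 0) \<and> F $$ 0 = 1"
  thus "unit1 F" by (auto simp: unit1_def vanish_def)
qed

lemma unit1_imp_vanish: "unit1 F \<Longrightarrow> vanish 0 F"
  by (auto simp: unit1_iff vanish_def)

lemma unit1_1 [simp]: "unit1 1"
  by (simp add: unit1_def)

lemma unit1_nonzero: "unit1 F \<Longrightarrow> F \<noteq> 0"
  by (auto simp: unit1_iff)

lemma unit1_mult: 
  assumes "unit1 F" "unit1 G" shows "unit1 (F * G)"
proof -
  have "vanish (0 + 1) (F * (G - 1))"
    using assms(2) unit1_imp_vanish[OF assms(1)] by (intro vanish_mult) (auto simp: unit1_def)
  moreover have "vanish 1 (F - 1)"
    using assms(1) by (simp add: unit1_def)
  ultimately have "vanish 1 (F * (G - 1) + (F - 1))" by (intro vanish_add) auto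
  thus ?thesis by (simp add: unit1_def algebra_simps)
qed

lemma unit1_power: "unit1 F \<Longrightarrow> unit1 (F ^ n)"
  by (induction n) (auto intro: unit1_mult)

lemma unit1_inverse:
  assumes "unit1 F" shows "unit1 (inverse F)"
proof -
  have "fls_subdegree F = 0" using assms by (intro fls_subdegree_eqI) (auto simp: unit1_iff)
  hence sd: "fls_subdegree (inverse F) = 0" by simp
  hence v: "vanish 0 (inverse F)" by (simp add: vanish_def)
  have "vanish (0 + 1) (inverse F * (1 - F))"
    using v vanish_diff[of 1 0 "F - 1"] assms by (intro vanish_mult) (auto simp: unit1_def)
  thus ?thesis using unit1_nonzero[OF assms] by (simp add: unit1_def algebra_simps)
qed

lemma unit1_divide: "unit1 F \<Longrightarrow> unit1 G \<Longrightarrow> unit1 (F / G)"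
  by (simp add: divide_inverse unit1_mult unit1_inverse)

lemma unit1_dil: "unit1 F \<Longrightarrow> unit1 (dil F)"
  by (auto simp: unit1_iff dil_nth)

lemma unit1_add_vanish: "unit1 F \<Longrightarrow> vanish 1 G \<Longrightarrow> unit1 (F + G)"
  using vanish_add[of 1 "F - 1" G] by (simp add: unit1_def algebra_simps)

section \<open>Euler's function\<close>

definition eprod :: "nat \<Rightarrow> complex fls" where
  "eprod n = (\<Prod>k<n. 1 - fls_X ^ Suc k)"

text \<open>Factors after the n-th only affect exponents above n, so the n-th coefficient of the
  n-th partial product is final.\<close>

definition euler :: "complex fls" where
  "euler = fps_to_fls (Abs_fps (\<lambda>n. eprod n $$ int n))"

definition lambert :: "nat \<Rightarrow> complex fls" where
  "lambert r = fps_to_fls (Abs_fps (\<lambda>n. if n = 0 then 0 else of_nat (\<Sum>d | d dvd n. d ^ r)))"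

lemma eprod_Suc: "eprod (Suc n) = eprod n * (1 - fls_X ^ Suc n)"
  by (simp add: eprod_def)

lemma eprod_0 [simp]: "eprod 0 = 1"
  by (simp add: eprod_def)

lemma unit1_eprod [simp]: "unit1 (eprod n)"
proof (induction n)
  case (Suc n)
  have "vanish 1 (- (fls_X ^ Suc n) :: complex fls)" by (auto simp: vanish_def simp del: power_Suc)
  hence "unit1 (1 + (- (fls_X ^ Suc n)) :: complex fls)" by (intro unit1_add_vanish) auto
  thus ?case using Suc by (simp add: eprod_Suc unit1_mult del: power_Suc)
qed simp

lemma eprod_nonzero [simp]: "eprod n \<noteq> 0"
  using unit1_nonzero[OF unit1_eprod] .

lemma vanish_eprod_diff: "n \<le> N \<Longrightarrow> vanish (int n + 1) (eprod N - eprod n)"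
proof (induction N rule: dec_induct)
  case (step N)
  have "vanish (0 + int (Suc N)) (eprod N * fls_X ^ Suc N)"
    by (intro vanish_mult unit1_imp_vanish unit1_eprod vanish_X_power)
  hence "vanish (int n + 1) (eprod N * fls_X ^ Suc N)"
    using step.hyps by (rule_tac vanish_mono) auto
  from vanish_diff[OF step.IH this]
  have "vanish (int n + 1) ((eprod N - eprod n) - eprod N * fls_X ^ Suc N)" .
  thus ?case by (simp add: eprod_Suc algebra_simps)
qed simp

lemma euler_nth: "euler $$ int n = eprod n $$ int n"
  by (simp add: euler_def)

lemma vanish_euler_diff: "vanish (int n + 1) (euler - eprod n)"
  unfolding vanish_def
proof safe
  fix m :: int assume m: "m < int n + 1"
  show "(euler - eprod n) $$ m = 0"
  proof (cases "m < 0")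
    case True
    thus ?thesis using unit1_imp_vanish[OF unit1_eprod] by (simp add: euler_def vanish_def)
  next
    case False
    with m obtain k where "m = int k" "k \<le> n" by (metis int_nat_eq linorder_not_less nat_le_iff zless_add1_eq le_less)
    thus ?thesis using vanish_eprod_diff[of k n] by (simp add: vanish_def euler_nth)
  qed
qed

lemma unit1_euler [simp]: "unit1 euler"
  using unit1_add_vanish[OF unit1_eprod[of 0], of "euler - eprod 0"] vanish_euler_diff[of 0] by simp

lemma euler_nonzero [simp]: "euler \<noteq> 0"
  using unit1_nonzero[OF unit1_euler] .

lemma vanish_all_imp_0: "(\<And>n. vanish (int n) F) \<Longrightarrow> F = 0"
proof (rule fls_eqI)
  fix m assume "\<And>n. vanish (int n) F"
  from this[of "nat (m + 1)"] show "F $$ m = 0 $$ m" by (auto simp: vanish_def split: if_splits)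
qed

text \<open>The expansion of q^j / (1 - q^j).\<close>

definition geom :: "nat \<Rightarrow> complex fls" where
  "geom j = fps_to_fls (Abs_fps (\<lambda>n. if n > 0 \<and> j dvd n then 1 else 0))"

lemma geom_nth: "geom j $$ n = (if n > 0 \<and> int j dvd n then 1 else 0)"
  by (cases n rule: int_cases2) (auto simp: geom_def)

lemma geom_eq: "j > 0 \<Longrightarrow> (1 - fls_X ^ j) * geom j = fls_X ^ j"
proof (rule fls_eqI)
  fix n assume "j > 0"
  thus "((1 - fls_X ^ j) * geom j) $$ n = fls_X ^ j $$ n"
    by (auto simp: algebra_simps fls_X_power_times_conv_shift geom_nth dest: zdvd_imp_le)
qed

lemma qderiv_X_power: "qderiv (fls_X ^ j :: complex fls) = of_nat j * fls_X ^ j"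
  by (rule fls_eqI) (simp add: fls_X_power_nth)

lemma qderiv_eprod: "qderiv (eprod n) = - eprod n * (\<Sum>k<n. of_nat (Suc k) * geom (Suc k))"
proof (induction n)
  case (Suc n)
  have "qderiv (eprod (Suc n)) = - eprod (Suc n) * (\<Sum>k<n. of_nat (Suc k) * geom (Suc k)) -
          eprod n * (of_nat (Suc n) * fls_X ^ Suc n)"
    by (simp add: eprod_Suc qderiv_mult Suc.IH qderiv_X_power algebra_simps del: power_Suc of_nat_Suc)
  also have "eprod n * (of_nat (Suc n) * fls_X ^ Suc n) = eprod (Suc n) * (of_nat (Suc n) * geom (Suc n))"
    by (subst geom_eq[symmetric]) (simp_all add: eprod_Suc algebra_simps del: power_Suc of_nat_Suc)
  finally show ?case by (simp only: sum.lessThan_Suc distrib_left) (simp del: of_nat_Suc)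
qed simp

lemma lambert_nth: "lambert r $$ n = (if n > 0 then of_nat (\<Sum>d | d dvd nat n. d ^ r) else 0)"
  by (auto simp: lambert_def)

lemma vanish_lambert [simp]: "vanish 1 (lambert r)"
  by (auto simp: vanish_def lambert_nth)

lemma vanish_geom_lambert: "vanish (int n + 1) ((\<Sum>k<n. of_nat (Suc k) * geom (Suc k)) - lambert 1)"
  unfolding vanish_def
proof safe
  fix m :: int assume m: "m < int n + 1"
  show "((\<Sum>k<n. of_nat (Suc k) * geom (Suc k)) - lambert 1) $$ m = 0"
  proof (cases "m > 0")
    case True
    then obtain l where l: "m = int l" "l > 0" by (metis pos_int_cases)
    have "(\<Sum>k<n. of_nat (Suc k) * geom (Suc k)) $$ m = 
            (\<Sum>k<n. if Suc k dvd l then of_nat (Suc k) else 0)"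
      using l by (auto simp: fls_nth_sum geom_nth fls_mult_of_nat_nth int_dvd_int_iff simp del: of_nat_Suc intro!: sum.cong)
    also have "\<dots> = (\<Sum>d\<in>Suc ` {..<n}. if d dvd l then of_nat d else 0)"
      by (subst sum.reindex) auto
    also have "\<dots> = (\<Sum>d | d dvd l. of_nat d)"
    proof -
      have "d \<in> {1..n}" if "d dvd l" for d
        using that dvd_imp_le[OF that l(2)] dvd_pos_nat[OF l(2) that] l(1) m by auto
      thus ?thesis
        unfolding image_Suc_lessThan by (intro sum.mono_neutral_cong_right) auto
    qed
    finally show ?thesis using l by (simp add: lambert_nth)
  qed (auto simp: fls_nth_sum lambert_nth geom_nth fls_mult_of_nat_nth simp del: of_nat_Suc)
qed

lemma qderiv_euler: "qderiv euler = - euler * lambert 1"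
proof -
  have "qderiv euler + euler * lambert 1 = 0"
  proof (rule vanish_all_imp_0)
    fix n
    let ?s = "\<Sum>k<n. of_nat (Suc k) * geom (Suc k) :: complex fls"
    have "vanish (int n + 1) (qderiv (euler - eprod n))"
      using vanish_euler_diff[of n] by (auto simp: vanish_def)
    moreover have "vanish (int n + 1 + 1) ((euler - eprod n) * lambert 1)"
      by (intro vanish_mult vanish_euler_diff vanish_lambert)
    hence "vanish (int n + 1) ((euler - eprod n) * lambert 1)"
      by (rule vanish_mono) simp
    moreover have "vanish (0 + (int n + 1)) (eprod n * (?s - lambert 1))"
      by (intro vanish_mult vanish_geom_lambert unit1_imp_vanish unit1_eprod)
    ultimately have "vanish (int n + 1) (qderiv (euler - eprod n) + (euler - eprod n) * lambert 1 -
      eprod n * (?s - lambert 1))"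
      by (intro vanish_diff vanish_add) auto
    also have "qderiv (euler - eprod n) + (euler - eprod n) * lambert 1 - eprod n * (?s - lambert 1) =
       qderiv euler + euler * lambert 1"
      unfolding qderiv_simps qderiv_eprod by (simp add: algebra_simps)
    finally show "vanish (int n) (qderiv euler + euler * lambert 1)"
      by (rule vanish_mono) simp
  qed
  thus ?thesis by (simp add: add_eq_0_iff2)
qed

lemma logder_euler: "logder euler = - lambert 1"
  by (simp add: logder_def qderiv_euler)

section \<open>The pentagonal number theorem\<close>

fun tri :: "nat \<Rightarrow> nat" where
  "tri 0 = 0"
| "tri (Suc n) = tri n + Suc n"

lemma two_tri: "2 * tri n = n * (n + 1)"
  by (induction n) auto

lemma tri_ge: "n \<le> tri n"
  by (induction n) auto

text \<open>Shanks's finite form of the pentagonal number theorem. The term \<open>s = 0\<close> is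
  \<open>eprod n\<close> and all others are O(q^(n+1)), while the whole sum equals the pentagonal
  series cut off at |s| <= n.\<close>

definition shanks_sum :: "nat \<Rightarrow> complex fls" where
  "shanks_sum n = (\<Sum>s\<le>n. (-1) ^ s * (eprod n / eprod s) * fls_X ^ (s * n + tri s))"

lemma shanks_sum_Suc:
  "shanks_sum (Suc n) = shanks_sum n + 
     (-1) ^ Suc n * (fls_X ^ (Suc n ^ 2 + tri n) + fls_X ^ (Suc n ^ 2 + tri (Suc n)))"
proof -
  \<comment> \<open>\<open>T\<close> is the telescoping certificate: the partial sums for
    \<open>Suc n\<close> and for \<open>n\<close> up to the same index differ by it. The index
    \<open>Suc n\<close> occurs only in the former and supplies the second new pentagonal
    term.\<close>
  define T where "T = (\<lambda>s. (-1) ^ s * (eprod n / eprod s) * fls_X ^ (Suc s * Suc n + tri s))"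
  let ?X = "fls_X :: complex fls"
  have *: "(\<Sum>s\<le>m. (-1) ^ s * (eprod (Suc n) / eprod s) * ?X ^ (s * Suc n + tri s)) =
        (\<Sum>s\<le>m. (-1) ^ s * (eprod n / eprod s) * ?X ^ (s * n + tri s)) - T m" for m
  proof (induction m)
    case 0
    show ?case by (simp add: T_def eprod_Suc algebra_simps)
  next
    case (Suc m)
    have "(-1) ^ Suc m * (eprod (Suc n) / eprod (Suc m)) * ?X ^ (Suc m * Suc n + tri (Suc m)) =
       (-1) ^ Suc m * (eprod n / eprod (Suc m)) * ?X ^ (Suc m * n + tri (Suc m)) + T m - T (Suc m)"
    proof -
      have "1 - ?X ^ Suc m \<noteq> 0"
        using eprod_nonzero[of "Suc m"] unfolding eprod_Suc by (simp del: eprod_nonzero)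
      hence e: "eprod n / eprod m = (1 - ?X ^ Suc m) * (eprod n / eprod (Suc m))"
        by (simp add: eprod_Suc field_simps del: power_Suc)
      have p: "?X ^ (Suc m * Suc n + tri (Suc m)) = ?X ^ Suc m * ?X ^ (Suc m * n + tri (Suc m))"
        "?X ^ (Suc m * Suc n + tri m) = ?X ^ (Suc m * n + tri (Suc m))"
        "?X ^ (Suc (Suc m) * Suc n + tri (Suc m)) = ?X ^ Suc n * ?X ^ Suc m * ?X ^ (Suc m * n + tri (Suc m))"
        by (simp_all flip: power_add add: algebra_simps)
      show ?thesis
        unfolding T_def e p eprod_Suc[of n]
        by (simp add: algebra_simps diff_divide_distrib del: power_Suc) (simp add: algebra_simps)
    qed
    thus ?case using Suc by (simp del: power_Suc)
  qed
  have "shanks_sum (Suc n) = shanks_sum n - T n + (-1) ^ Suc n * ?X ^ (Suc n ^ 2 + tri (Suc n))"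
    unfolding shanks_sum_def[of "Suc n"] sum.atMost_Suc *[of n]
    by (simp add: shanks_sum_def power2_eq_square del: power_Suc mult_Suc tri.simps)
  thus ?thesis by (simp add: T_def algebra_simps power2_eq_square)
qed

lemma minus_one_power_mult_nth: "((-1) ^ n * F :: complex fls) $$ m = (-1) ^ n * F $$ m"
  by (cases "even n") auto

lemma shanks_sum_nth:
  "shanks_sum n $$ m = (\<Sum>s\<in>{- int n..int n}. if s * (3 * s + 1) = 2 * m then (-1) ^ nat \<bar>s\<bar> else 0)"
proof (induction n)
  case 0
  show ?case by (simp add: shanks_sum_def)
next
  case (Suc n)
  have eq: "{- int (Suc n)..int (Suc n)} = insert (int (Suc n)) (insert (- int (Suc n)) {- int n..int n})"
    by auto
  have t: "2 * int (tri n) = int n * (int n + 1)" "2 * int (tri (Suc n)) = (int n + 1) * (int n + 2)"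
    using arg_cong[OF two_tri[of n], of int] by (simp_all add: algebra_simps)
  have "int (Suc n) * (3 * int (Suc n) + 1) = 2 * m \<longleftrightarrow> m = int (Suc n ^ 2 + tri (Suc n))"
    "- int (Suc n) * (3 * (- int (Suc n)) + 1) = 2 * m \<longleftrightarrow> m = int (Suc n ^ 2 + tri n)"
    using t by (auto simp: power2_eq_square algebra_simps)
  moreover have "nat \<bar>int (Suc n)\<bar> = Suc n" "nat \<bar>- int (Suc n)\<bar> = Suc n" by simp_all
  moreover have "tri n \<noteq> tri (Suc n)" by simp
  ultimately show ?case unfolding eq shanks_sum_Suc
    by (subst sum.insert, simp, simp, subst sum.insert, simp, simp)
       (simp add: Suc.IH minus_one_power_mult_nth algebra_simps del: power_Suc of_nat_Suc tri.simps)
qed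

definition pent :: "int \<Rightarrow> complex" where
  "pent m = (\<Sum>s | s * (3 * s + 1) = 2 * m. (-1) ^ nat \<bar>s\<bar>)"

lemma pentagonal_abs_le:
  assumes "s * (3 * s + 1) = 2 * (m :: int)"
  shows "\<bar>s\<bar> \<le> m"
proof -
  have "2 * \<bar>s\<bar> \<le> s * (3 * s + 1)"
  proof (cases "s \<ge> 1")
    case True
    thus ?thesis using mult_mono[of 2 "3 * s + 1" s s] by (simp add: mult.commute)
  next
    case False
    hence "s = 0 \<or> s \<le> -1" by linarith
    moreover have "(- s) * 2 \<le> (- s) * (- (3 * s + 1))" if "s \<le> -1"
      using that by (intro mult_left_mono) auto
    ultimately show ?thesis by (auto simp: algebra_simps)
  qed
  with assms show ?thesis by linarith
qed

lemma vanish_euler_shanks: "vanish (int n + 1) (euler - shanks_sum n)"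
proof -
  have "shanks_sum n = eprod n + (\<Sum>s=1..n. (-1) ^ s * (eprod n / eprod s) * fls_X ^ (s * n + tri s))"
    unfolding shanks_sum_def atMost_atLeast0 by (subst sum.atLeast_Suc_atMost) simp_all
  moreover have "vanish (int n + 1) ((-1) ^ s * (eprod n / eprod s) * fls_X ^ (s * n + tri s))"
    if "s \<in> {1..n}" for s
  proof -
    have "vanish 0 (eprod n / eprod s)"
      by (intro unit1_imp_vanish unit1_divide unit1_eprod)
    hence "vanish (0 + int (s * n + tri s)) (((-1) ^ s * (eprod n / eprod s)) * fls_X ^ (s * n + tri s))"
      unfolding vanish_def[of 0]
      by (intro vanish_mult vanish_X_power) (simp add: vanish_def minus_one_power_mult_nth del: times_divide_eq_right)
    moreover have "n + 1 \<le> s * n + tri s"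
      using that tri_ge[of s] by (intro add_mono) auto
    hence "int n + 1 \<le> 0 + int (s * n + tri s)" by linarith
    ultimately show ?thesis by (rule vanish_mono)
  qed
  ultimately have "vanish (int n + 1) (shanks_sum n - eprod n)"
    by (auto intro: vanish_sum)
  from vanish_diff[OF vanish_euler_diff this] show ?thesis by simp
qed

lemma euler_pentagonal: "euler $$ m = pent m"
proof -
  define n where "n = nat m"
  have "(euler - shanks_sum n) $$ m = 0"
    using vanish_euler_shanks[of n] by (simp add: vanish_def n_def)
  hence "euler $$ m = (\<Sum>s\<in>{- int n..int n}. if s * (3 * s + 1) = 2 * m then (-1) ^ nat \<bar>s\<bar> else 0)"
    by (simp add: shanks_sum_nth)
  also have "\<dots> = pent m"
    unfolding pent_def 
    by (rule sum.mono_neutral_cong_right) (use pentagonal_abs_le[of _ m] in \<open>auto simp: n_def\<close>, fastforce+)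
  finally show ?thesis .
qed

lemma pentagonal_mod_5:
  assumes "s * (3 * s + 1) = 2 * (m :: int)"
  shows "m mod 5 \<in> {0, 1, 2}" and "m mod 5 = 1 \<longleftrightarrow> s mod 5 = 4"
proof -
  have "2 * m mod 5 = (s mod 5) * (3 * (s mod 5) + 1) mod 5"
    unfolding assms[symmetric] by (intro mod_mult_cong mod_add_cong) (simp_all add: mod_mult_right_eq)
  moreover have "s mod 5 \<in> {0, 1, 2, 3, 4}" by auto
  ultimately have "s mod 5 \<in> {0, 3} \<and> 2 * m mod 5 = 0 \<or> s mod 5 \<in> {1, 2} \<and> 2 * m mod 5 = 4 \<or>
    s mod 5 = 4 \<and> 2 * m mod 5 = 2" by auto
  moreover have "2 * m mod 5 = 0 \<Longrightarrow> m mod 5 = 0" "2 * m mod 5 = 4 \<Longrightarrow> m mod 5 = 2"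
     "2 * m mod 5 = 2 \<Longrightarrow> m mod 5 = 1" by presburger+
  ultimately show "m mod 5 \<in> {0, 1, 2}" "m mod 5 = 1 \<longleftrightarrow> s mod 5 = 4" by auto
qed

lemma pent_eq_0: "m mod 5 \<in> {3, 4} \<Longrightarrow> pent m = 0"
proof -
  assume "m mod 5 \<in> {3, 4}"
  hence "{s. s * (3 * s + 1) = 2 * m} = {}" using pentagonal_mod_5(1)[of _ m] by auto
  thus ?thesis by (simp add: pent_def)
qed

text \<open>Exactly the indices s = -5k-1 contribute, and s(3s+1)/2 = 25 k(3k+1)/2 + 1 with the sign
  reversed. So this residue class of the series is -q E(q^25).\<close>

lemma pent_mod_1:
  assumes "m mod 5 = 1"
  shows "pent m = (if 25 dvd (m - 1) then - pent ((m - 1) div 25) else 0)"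
proof -
  have *: "\<exists>k. s = - 5 * k - 1 \<and> m - 1 = 25 * (k * (3 * k + 1) div 2)" if s: "s * (3 * s + 1) = 2 * m" for s
  proof -
    have "s mod 5 = 4" using pentagonal_mod_5(2)[OF s] assms by simp
    hence "\<exists>k. s = - 5 * k - 1" by presburger
    then obtain k where k: "s = - 5 * k - 1" by blast
    have "2 * (m - 1) = 25 * (k * (3 * k + 1))" using s unfolding k by (simp add: algebra_simps)
    moreover have "even (k * (3 * k + 1))" by auto
    then obtain j where "k * (3 * k + 1) = 2 * j" by (rule evenE)
    ultimately show ?thesis using k by (intro exI[of _ k]) auto
  qed
  show ?thesis
  proof (cases "25 dvd (m - 1)")
    case True
    then obtain l where l: "m = 25 * l + 1" by (metis add.commute diff_add_cancel dvdE)
    have "pent m = (\<Sum>k | k * (3 * k + 1) = 2 * l. - ((-1) ^ nat \<bar>k\<bar>))"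
      unfolding pent_def
    proof (rule sum.reindex_bij_witness[of _ "\<lambda>k. - 5 * k - 1" "\<lambda>s. - ((s + 1) div 5)"])
      fix s assume "s \<in> {s. s * (3 * s + 1) = 2 * m}"
      with *[of s] obtain k where k: "s = - 5 * k - 1" "m - 1 = 25 * (k * (3 * k + 1) div 2)" by auto
      hence k': "- ((s + 1) div 5) = k" by simp
      show "- 5 * - ((s + 1) div 5) - 1 = s" unfolding k' using k by simp
      have "l = k * (3 * k + 1) div 2" using k(2) l by simp
      moreover have "even (k * (3 * k + 1))" by auto
      ultimately show "- ((s + 1) div 5) \<in> {k. k * (3 * k + 1) = 2 * l}" unfolding k' by auto
      have "even (nat \<bar>s\<bar>) \<longleftrightarrow> odd (nat \<bar>k\<bar>)" unfolding k(1) by (simp add: even_nat_iff)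
      thus "- ((-1) ^ nat \<bar>- ((s + 1) div 5)\<bar>) = ((-1) ^ nat \<bar>s\<bar> :: complex)"
        unfolding k' by (cases "even (nat \<bar>s\<bar>)") auto
    next
      fix k assume "k \<in> {k. k * (3 * k + 1) = 2 * l}"
      thus "- 5 * k - 1 \<in> {s. s * (3 * s + 1) = 2 * m}" by (simp add: l algebra_simps)
    qed auto
    thus ?thesis using l by (simp add: pent_def sum_negf)
  next
    case False
    hence "{s. s * (3 * s + 1) = 2 * m} = {}" using * by (metis (mono_tags, lifting) Collect_empty_eq dvd_triv_left)
    thus ?thesis using False by (simp add: pent_def)
  qed
qed

text \<open>Exponents 3 and 4 mod 5 do not occur and class 1 is explicit. Dividing by q^2 moves
  class 2 to class 0, where \<open>sect\<close> can see it.\<close>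

lemma euler_dissection:
  "euler = dil (sect euler) - fls_X * dil (dil euler) + fls_X ^ 2 * dil (sect (euler / fls_X ^ 2))"
proof (rule fls_eqI)
  fix m :: int
  have X: "euler / fls_X ^ 2 = fls_shift 2 euler"
    by (simp add: fls_divide_X_power)
  have 25: "(m - 1) mod 5 = 0 \<and> 5 dvd (m - 1) div 5 \<longleftrightarrow> 25 dvd (m - 1)" by presburger
  have d: "(m - 1) div 5 div 5 = (m - 1) div 25" by (simp flip: zdiv_zmult2_eq)
  have "m mod 5 \<in> {0, 1, 2, 3, 4}" by auto
  moreover have "5 dvd m \<longleftrightarrow> m mod 5 = 0" "5 dvd (m - 1) \<longleftrightarrow> m mod 5 = 1" "5 dvd (m - 2) \<longleftrightarrow> m mod 5 = 2"
    by presburger+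
  moreover have "m mod 5 = 0 \<Longrightarrow> 5 * (m div 5) = m" "m mod 5 = 2 \<Longrightarrow> 5 * ((m - 2) div 5) + 2 = m"
    by presburger+
  ultimately show "euler $$ m = (dil (sect euler) - fls_X * dil (dil euler) +
      fls_X ^ 2 * dil (sect (euler / fls_X ^ 2))) $$ m"
    using pent_eq_0[of m] pent_mod_1[of m] 25 unfolding X
    by (auto simp: fls_X_times_conv_shift fls_X_power_times_conv_shift dil_nth euler_pentagonal d)
qed


section \<open>Jacobi's identity for the cube of Euler's function\<close>

definition alt :: "int \<Rightarrow> complex fls" where
  "alt k = (if even k then 1 else -1)"

definition reprod :: "int \<Rightarrow> complex fls" where
  "reprod m = (if m < 0 then 0 else inverse (eprod (nat m)))"

text \<open>\<open>jac n k\<close> is the coefficient of \<open>z\<^sup>k\<close> in the finite triple product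
  \<open>(1 - zq)\<cdots>(1 - zq\<^sup>n) (1 - 1/z)(1 - q/z)\<cdots>(1 - q\<^sup>n/z)\<close>; \<open>jac_sum\<close> is twice its derivative at \<open>z = 1\<close>.
  Extending \<open>1/(q;q)\<^sub>m\<close> by 0 to \<open>m < 0\<close> makes the recurrence \<open>jac_Suc\<close> valid for all integers \<open>k\<close>.\<close>

definition jac :: "nat \<Rightarrow> int \<Rightarrow> complex fls" where
  "jac n k = alt k * fls_X powi (k * (k + 1) div 2) * eprod (2 * n + 1) *
     reprod (int n - k) * reprod (int n + k + 1)"

text \<open>At \<open>m = 0\<close> both sides are 0 because 1 - q^0 = 0, so the extension by 0 is
  consistent with the recurrence.\<close>

lemma reprod_rec: "reprod (m - 1) = (1 - fls_X powi m) * reprod m"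
proof -
  consider "m < 0" | "m = 0" | k where "m = int (Suc k)"
    by (metis Suc_pred' linorder_neqE_linordered_idom zero_less_imp_eq_int)
  thus ?thesis
  proof cases
    case 3
    have "1 - fls_X ^ Suc k \<noteq> (0 :: complex fls)"
      using eprod_nonzero[of "Suc k"] unfolding eprod_Suc by (simp del: eprod_nonzero)
    thus ?thesis using 3
      by (simp add: reprod_def eprod_Suc power_int_of_nat field_simps del: power_Suc of_nat_Suc)
         (simp add: nat_diff_distrib)
  qed (auto simp: reprod_def)
qed

text \<open>The triple product acquires the factor (1 - z q^(n+1)) (1 - q^(n+1)/z) = 1 + q^(2n+2) -
  q^(n+1) (z + 1/z).\<close>

lemma jac_Suc:
  "jac (Suc n) k = (1 + fls_X ^ (2 * n + 2)) * jac n k - fls_X ^ Suc n * (jac n (k - 1) + jac n (k + 1))"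
proof -
  let ?X = "fls_X :: complex fls"
  define N where "N = int n + 1"
  define A where "A = ?X powi (N - k)"
  define B where "B = ?X powi (N + k)"
  define T where "T = ?X powi (k * (k + 1) div 2)"
  define C where "C = alt k * eprod (2 * n + 1) * reprod (N - k) * reprod (N + k + 1)"
  have X: "?X \<noteq> 0" by simp
  have a: "alt (k - 1) = - alt k" "alt (k + 1) = - alt k" by (auto simp: alt_def)
  have t: "(k - 1) * (k - 1 + 1) div 2 = k * (k + 1) div 2 - k" 
    "(k + 1) * (k + 1 + 1) div 2 = k * (k + 1) div 2 + (k + 1)"
  proof -
    have *: "(k - 1) * (k - 1 + 1) = k * (k + 1) + (- k) * 2" "(k + 1) * (k + 1 + 1) = k * (k + 1) + (k + 1) * 2"
      by (simp_all add: algebra_simps)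
    show "(k - 1) * (k - 1 + 1) div 2 = k * (k + 1) div 2 - k" 
      "(k + 1) * (k + 1 + 1) div 2 = k * (k + 1) div 2 + (k + 1)"
      unfolding * by (subst div_mult_self1; simp)+
  qed
  have AX: "?X powi (N - k - 1) = A / ?X" "?X powi (N + k + 1) = B * ?X"
    using X by (simp_all add: A_def B_def power_int_add power_int_diff)
  have AB: "A * B = ?X ^ (2 * n + 2)"
  proof -
    have "A * B = ?X powi (int (2 * n + 2))"
      using X by (simp add: A_def B_def N_def power_int_add[symmetric] add.commute)
    thus ?thesis by (simp only: power_int_of_nat)
  qed
  have XN: "?X ^ Suc n = ?X powi N" by (simp add: N_def power_int_add)
  have e: "eprod (2 * Suc n + 1) = eprod (2 * n + 1) * (1 - A * B) * (1 - A * B * ?X)"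
    unfolding AB by (simp add: eprod_Suc algebra_simps)
  have r: "reprod (N - k - 1) = (1 - A) * reprod (N - k)"
    "reprod (N - k - 1 - 1) = (1 - A / ?X) * (1 - A) * reprod (N - k)"
    "reprod (N + k) = (1 - B * ?X) * reprod (N + k + 1)"
    "reprod (N + k - 1) = (1 - B) * (1 - B * ?X) * reprod (N + k + 1)"
    using reprod_rec[of "N - k"] reprod_rec[of "N - k - 1"] reprod_rec[of "N + k + 1"] reprod_rec[of "N + k"]
    by (simp_all add: AX A_def[symmetric] B_def[symmetric])
  \<comment> \<open>Each of the four \<open>jac\<close> terms is \<open>T * C\<close> times a
    polynomial in \<open>A\<close>, \<open>B\<close>, q and \<open>A / q\<close>, so a polynomial
    identity remains.\<close>
  have j1: "jac n k = T * C * (1 - A) * (1 - B * ?X)"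
  proof -
    have *: "int n - k = N - k - 1" "int n + k + 1 = N + k" by (simp_all add: N_def)
    show ?thesis unfolding jac_def * r T_def C_def by (simp only: mult_ac)
  qed
  have j2: "?X ^ Suc n * jac n (k - 1) = - A * T * C * (1 - B) * (1 - B * ?X)"
  proof -
    have *: "int n - (k - 1) = N - k" "int n + (k - 1) + 1 = N + k - 1"
      by (simp_all add: N_def)
    have "?X ^ Suc n * ?X powi (k * (k + 1) div 2 - k) = A * T"
      unfolding XN A_def T_def using X by (simp add: power_int_diff field_simps)
    moreover define P Y where "P = ?X powi (k * (k + 1) div 2 - k)" and "Y = ?X ^ Suc n"
    ultimately show ?thesis unfolding jac_def a t * r C_def P_def[symmetric] Y_def[symmetric] by Groebner_Basis.algebra
  qed
  have j3: "?X ^ Suc n * jac n (k + 1) = - B * ?X * T * C * (1 - A / ?X) * (1 - A)"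
  proof -
    have *: "int n - (k + 1) = N - k - 1 - 1" "int n + (k + 1) + 1 = N + k + 1"
      by (simp_all add: N_def)
    have "?X ^ Suc n * ?X powi (k * (k + 1) div 2 + (k + 1)) = B * ?X * T"
      unfolding XN B_def T_def using X by (simp add: power_int_add field_simps)
    moreover define P Y where "P = ?X powi (k * (k + 1) div 2 + (k + 1))" and "Y = ?X ^ Suc n"
    moreover define R where "R = A / ?X"
    ultimately show ?thesis
      unfolding jac_def a t * r C_def P_def[symmetric] Y_def[symmetric] R_def[symmetric] by Groebner_Basis.algebra
  qed
  have "jac (Suc n) k = T * C * (1 - A * B) * (1 - A * B * ?X)"
    unfolding jac_def e by (simp add: T_def C_def N_def algebra_simps)
  moreover define R where "R = A / ?X"
  moreover have "A = R * ?X" using X by (simp add: R_def del: fls_divide_X)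
  ultimately show ?thesis
    unfolding distrib_left j1 j2 j3 AB[symmetric] R_def[symmetric] by Groebner_Basis.algebra
qed

lemma jac_eq_0: "k > int n \<or> k < - int n - 1 \<Longrightarrow> jac n k = 0"
  by (auto simp: jac_def reprod_def)

lemma sum_telescope_int:
  fixes G :: "int \<Rightarrow> 'a::ab_group_add"
  assumes "a \<le> b"
  shows "(\<Sum>k\<in>{a..b}. G (k + 1) - G k) = G (b + 1) - G a"
  using assms
proof (induction b rule: int_ge_induct)
  case (step i)
  have "{a..i+1} = insert (i + 1) {a..i}" using step by auto
  thus ?case using step by simp
qed simp

lemma jac_sum:
  assumes "n < M"
  shows "(\<Sum>k\<in>{-int M..int M}. of_int (2 * k + 1) * jac n k) = 2 * eprod n ^ 2"
  using assms
proof (induction n)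
  case 0
  have "(\<Sum>k\<in>{-int M..int M}. of_int (2 * k + 1) * jac 0 k) = (\<Sum>k\<in>{-1,0}. of_int (2 * k + 1) * jac 0 k)"
    using 0 by (intro sum.mono_neutral_right) (auto intro!: jac_eq_0)
  also have "\<dots> = 2"
    by (simp add: jac_def alt_def reprod_def)
  finally show ?case by simp
next
  case (Suc n)
  \<comment> \<open>With c(k) = \<open>jac n k\<close>, (2k+1) (c(k-1) + c(k+1)) is 2 (2k+1) c(k)
    plus the difference \<open>H k\<close> of \<open>G\<close>. This completes 1 + Y^2 to (1 - Y)^2.
    Keeping \<open>M\<close> fixed beyond the support of \<open>jac\<close> makes the boundary
    values of \<open>G\<close> zero.\<close>
  define G where "G = (\<lambda>k::int. of_int (2 * k - 1) * jac n k - of_int (2 * k + 1) * jac n (k - 1))"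
  define H where "H = (\<lambda>k. G (k + 1) - G k)"
  let ?Y = "fls_X ^ Suc n :: complex fls"
  have "of_int (2 * k + 1) * jac (Suc n) k = (1 - ?Y) ^ 2 * (of_int (2 * k + 1) * jac n k) - ?Y * H k"
    for k
  proof -
    have "2 * n + 2 = Suc n * 2" by simp
    hence "fls_X ^ (2 * n + 2) = ?Y ^ 2" by (simp only: power_mult)
    thus ?thesis unfolding jac_Suc H_def G_def
      by (simp add: power2_eq_square del: power_Suc) (simp add: algebra_simps del: power_Suc)
  qed
  hence "(\<Sum>k\<in>{-int M..int M}. of_int (2 * k + 1) * jac (Suc n) k) = 
     (1 - ?Y) ^ 2 * (\<Sum>k\<in>{-int M..int M}. of_int (2 * k + 1) * jac n k) -
     ?Y * (\<Sum>k\<in>{-int M..int M}. H k)"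
    by (simp only: sum_subtractf sum_distrib_left)
  also have "(\<Sum>k\<in>{-int M..int M}. H k) = G (int M + 1) - G (- int M)"
    unfolding H_def by (rule sum_telescope_int) simp
  also have "\<dots> = 0"
    using Suc.prems by (simp add: G_def jac_eq_0)
  also have "(\<Sum>k\<in>{-int M..int M}. of_int (2 * k + 1) * jac n k) = 2 * eprod n ^ 2"
    using Suc by simp
  finally show ?case unfolding eprod_Suc power_mult_distrib by (simp only: mult_ac mult_zero_left mult_zero_right diff_zero)
qed

lemma vanish_quot_minus_1:
  assumes "unit1 G" "vanish N (F - G)"
  shows "vanish N (F * inverse G - 1)"
proof -
  have "vanish (N + 0) ((F - G) * inverse G)"
    using assms by (intro vanish_mult unit1_imp_vanish unit1_inverse)
  thus ?thesis using unit1_nonzero[OF assms(1)] by (simp add: algebra_simps)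
qed

text \<open>With c = k(k+1)/2, a = n-k and b = n+k+1, the two quotients of products are 1 +
  O(q^(a+1)) and 1 + O(q^(b+1)), and both c+a and c+b are at least n.\<close>

lemma vanish_jac:
  assumes "k \<in> {- int n - 1..int n}"
  shows "vanish (int n + 1) (euler * jac n k - alt k * fls_X powi (k * (k + 1) div 2))"
proof -
  obtain a where a: "int n - k = int a" using assms zero_le_imp_eq_int[of "int n - k"] by auto
  obtain b where b: "int n + k + 1 = int b" using assms zero_le_imp_eq_int[of "int n + k + 1"] by auto
  define c where "c = nat (k * (k + 1) div 2)"
  have "0 \<le> k * (k + 1)" by (cases "k \<ge> 0") (auto intro: mult_nonpos_nonpos)
  hence c: "k * (k + 1) div 2 = int c" by (simp add: c_def)
  have "2 * int c = k * (k + 1)" unfolding c[symmetric] by simp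
  hence c_ge: "int c \<ge> k" "int c \<ge> - k - 1"
  proof -
    have "2 * k \<le> k * (k + 1)" if "k \<ge> 1"
      using mult_right_mono[of 2 "k + 1" k] that by (simp add: mult.commute)
    moreover have "2 * (- k - 1) \<le> k * (k + 1)" if "k \<le> -2"
      using mult_right_mono[of 2 "- k" "- k - 1"] that by (simp add: algebra_simps)
    ultimately show "int c \<ge> k" "int c \<ge> - k - 1"
      using \<open>2 * int c = k * (k + 1)\<close> by fastforce+
  qed
  define u where "u = euler * inverse (eprod a)"
  define v where "v = eprod (2 * n + 1) * inverse (eprod b)"
  have "b \<le> 2 * n + 1" using assms b by auto
  hence v: "vanish (int b + 1) (v - 1)" and u: "vanish (int a + 1) (u - 1)"
    unfolding u_def v_def by (intro vanish_quot_minus_1 vanish_euler_diff vanish_eprod_diff unit1_eprod; simp)+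
  have 0: "vanish 0 v" unfolding v_def
    by (intro unit1_imp_vanish unit1_mult unit1_inverse unit1_eprod)
  have "vanish (int a + 1 + 0) ((u - 1) * v)" by (intro vanish_mult u 0)
  hence "vanish (int (min a b) + 1) ((u - 1) * v + (v - 1))"
    using u v by (intro vanish_add) (auto elim: vanish_mono)
  hence "vanish (int c + (int (min a b) + 1)) (fls_X ^ c * ((u - 1) * v + (v - 1)))"
    by (intro vanish_mult vanish_X_power)
  moreover have "int n + 1 \<le> int c + (int (min a b) + 1)"
    using c_ge a b by (auto simp: min_def)
  ultimately have "vanish (int n + 1) (fls_X ^ c * ((u - 1) * v + (v - 1)))"
    by (rule vanish_mono)
  hence *: "vanish (int n + 1) (fls_X ^ c * (u * v - 1))"
    by (simp add: algebra_simps)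
  have "euler * jac n k - alt k * fls_X powi (k * (k + 1) div 2) = alt k * (fls_X ^ c * (u * v - 1))"
    unfolding jac_def c a b by (simp add: u_def v_def reprod_def power_int_of_nat algebra_simps)
  thus ?thesis using * by (auto simp: alt_def vanish_def)
qed

text \<open>Modulo q^(n+1), 2 E^3 is the sum of (2k+1) (-1)^k q^(k(k+1)/2) over -n-1 <= k <= n, and
  triangular numbers are 0, 1 or 3 mod 5.\<close>

lemma euler_cube_nth:
  assumes "m mod 5 = 2"
  shows "(euler ^ 3) $$ m = 0"
proof -
  define n where "n = nat m"
  define S where "S = (\<Sum>k\<in>{-int n-1..int n}. of_int (2 * k + 1) * (alt k * fls_X powi (k * (k + 1) div 2)))"
  have "2 * eprod n ^ 2 = (\<Sum>k\<in>{-int (Suc n)..int (Suc n)}. of_int (2 * k + 1) * jac n k)"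
    using jac_sum[of n "Suc n"] by simp
  also have "\<dots> = (\<Sum>k\<in>{-int n-1..int n}. of_int (2 * k + 1) * jac n k)"
    by (intro sum.mono_neutral_right) (auto intro!: jac_eq_0)
  finally have 1: "2 * euler * eprod n ^ 2 - S = (\<Sum>k\<in>{-int n-1..int n}. of_int (2 * k + 1) * 
      (euler * jac n k - alt k * fls_X powi (k * (k + 1) div 2)))"
    by (simp add: S_def sum_subtractf right_diff_distrib sum_distrib_left algebra_simps)
  have "vanish (0 + (int n + 1)) (of_int (2 * k + 1) * 
      (euler * jac n k - alt k * fls_X powi (k * (k + 1) div 2)))" if "k \<in> {-int n-1..int n}" for k
    by (intro vanish_mult vanish_jac that vanish_of_nat)
  hence "vanish (int n + 1) (2 * euler * eprod n ^ 2 - S)"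
    unfolding 1 by (intro vanish_sum) simp
  moreover have "vanish (0 + 0 + 0 + (int n + 1)) (2 * euler * (euler + eprod n) * (euler - eprod n))"
    by (intro vanish_mult vanish_euler_diff vanish_add unit1_imp_vanish unit1_euler unit1_eprod vanish_of_nat)
  ultimately have "vanish (int n + 1) (2 * euler * (euler + eprod n) * (euler - eprod n) + 
     (2 * euler * eprod n ^ 2 - S))"
    by (intro vanish_add) auto
  hence "vanish (int n + 1) (2 * euler ^ 3 - S)"
    by (simp add: algebra_simps power2_eq_square power3_eq_cube)
  hence "(2 * euler ^ 3) $$ m = S $$ m" by (auto simp: vanish_def n_def)
  also have "S $$ m = 0"
  proof -
    have "(of_int (2 * k + 1) * (alt k * fls_X powi (k * (k + 1) div 2))) $$ m = 0" for k
    proof -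
      have "k * (k + 1) div 2 \<noteq> m"
      proof
        assume "k * (k + 1) div 2 = m"
        moreover have "even (k * (k + 1))" by auto
        ultimately have "2 * m = k * (k + 1)" by auto
        hence "2 * m mod 5 = (k mod 5) * (k mod 5 + 1) mod 5"
          by (simp only:) (intro mod_mult_cong mod_add_cong; simp)
        moreover have "k mod 5 \<in> {0, 1, 2, 3, 4}" by auto
        ultimately have "2 * m mod 5 \<in> {0, 1, 2}" by auto
        thus False using assms by auto presburger+
      qed
      hence "(fls_X powi (k * (k + 1) div 2) :: complex fls) $$ m = 0"
        by (simp add: fls_X_power_int)
      thus ?thesis by (simp add: alt_def fls_of_int)
    qed
    thus ?thesis unfolding S_def fls_nth_sum by (intro sum.neutral) auto
  qed
  also have "(2 * euler ^ 3) $$ m = 2 * (euler ^ 3) $$ m"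
    by (metis fls_const_numeral fls_mult_const_nth(1))
  finally show ?thesis by simp
qed

section \<open>The modular equation of degree five\<close>

lemma sect_X_power_dil: "sect (fls_X ^ k * dil F :: complex fls) = (if 5 dvd k then fls_X ^ (k div 5) * F else 0)"
proof (cases "5 dvd k")
  case True
  then obtain j where "k = 5 * j" by blast
  hence "fls_X ^ k * dil F = dil (fls_X ^ j * F)"
    by (simp only: dil_simps power_mult)
  thus ?thesis using \<open>k = 5 * j\<close> by (simp only: sect_dil) simp
qed (simp add: sect_mult_dil sect_X_power)

lemma unit1_sect_euler: "unit1 (sect euler)"
  using unit1_euler by (auto simp: unit1_iff)

text \<open>In the cube of the dissection the exponents 2 mod 5 carry only 3a (ac + e^2), which
  \<open>euler_cube_nth\<close> annihilates. The factor q^3 moves this class to 0.\<close>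

lemma sect_euler_mult: "sect euler * sect (euler / fls_X ^ 2) = - (dil euler ^ 2)"
proof -
  define a where "a = sect euler"
  define c where "c = sect (euler / fls_X ^ 2)"
  define e where "e = dil euler"
  let ?X = "fls_X :: complex fls"
  have "euler = dil a - ?X * dil e + ?X ^ 2 * dil c"
    unfolding a_def c_def e_def by (rule euler_dissection)
  hence "?X ^ 3 * euler ^ 3 = ?X ^ 3 * (dil a - ?X * dil e + ?X ^ 2 * dil c) ^ 3"
    by simp
  also have "\<dots> = ?X ^ 3 * dil (a ^ 3) - ?X ^ 4 * dil (3 * a ^ 2 * e) + ?X ^ 5 * dil (3 * a ^ 2 * c + 3 * a * e ^ 2) -
     ?X ^ 6 * dil (e ^ 3 + 6 * a * e * c) + ?X ^ 7 * dil (3 * a * c ^ 2 + 3 * e ^ 2 * c) - 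
     ?X ^ 8 * dil (3 * e * c ^ 2) + ?X ^ 9 * dil (c ^ 3)"
    unfolding dil_simps dil_numeral by Groebner_Basis.algebra
  finally have "sect (?X ^ 3 * euler ^ 3) = ?X * (3 * a ^ 2 * c + 3 * a * e ^ 2)"
    by (simp only: sect_add sect_diff sect_X_power_dil) simp
  moreover have "sect (?X ^ 3 * euler ^ 3) = 0"
  proof (rule fls_eqI)
    fix n :: int
    have "(5 * n - 3) mod 5 = 2" by presburger
    from euler_cube_nth[OF this] show "sect (?X ^ 3 * euler ^ 3) $$ n = 0 $$ n"
      by (simp add: fls_X_power_times_conv_shift)
  qed
  moreover have "?X * (3 * a ^ 2 * c + 3 * a * e ^ 2) = ?X * (3 * a * (a * c + e ^ 2))" by Groebner_Basis.algebra
  ultimately have "3 * a * (a * c + e ^ 2) = 0"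
    by simp
  moreover have "a \<noteq> 0" unfolding a_def by (intro unit1_nonzero unit1_sect_euler)
  ultimately show ?thesis unfolding a_def c_def e_def by (simp add: add_eq_0_iff2)
qed


section \<open>Eta quotients of level five and their Rogers-Ramanujan parametrisation\<close>

definition eta_ratio :: "complex fls" where
  "eta_ratio = euler / (fls_X * dil (dil euler))"

definition hauptmodul :: "complex fls" where
  "hauptmodul = fls_X * dil euler ^ 6 / euler ^ 6"

definition eta_quot :: "complex fls" where
  "eta_quot = euler ^ 5 / dil euler"

definition eis2 :: "complex fls" where
  "eis2 = 1 - 24 * lambert 1"

definition eis2_5 :: "complex fls" where
  "eis2_5 = (5 * dil eis2 - eis2) / 4"

text \<open>The right side of Watson's equation is \<open>y * kpoly y\<close>. The factor is kept
  apart because \<open>hauptmodul\<close> turns out to be \<open>kpoly Y / Y ^ 5\<close>.\<close>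

definition kpoly :: "complex fls \<Rightarrow> complex fls" where
  "kpoly y = y ^ 4 + 5 * y ^ 3 + 15 * y ^ 2 + 25 * y + 25"

lemma eta_nonzero [simp]: "eta_ratio \<noteq> 0" "hauptmodul \<noteq> 0" "eta_quot \<noteq> 0"
  by (simp_all add: eta_ratio_def hauptmodul_def eta_quot_def)

lemma sect_X_powi_dil:
  "sect (fls_X powi k * dil F :: complex fls) = (if 5 dvd k then fls_X powi (k div 5) * F else 0)"
proof (cases "5 dvd k")
  case True
  then obtain j where j: "k = 5 * j" by blast
  hence "fls_X powi k * dil F = dil (fls_X powi j * F)"
    by (simp only: dil_simps dil_powi power_int_mult power_int_numeral)
  thus ?thesis using j by (simp only: sect_dil) simp
next
  case False
  have "sect (fls_X powi k :: complex fls) = 0"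
  proof (rule fls_eqI)
    fix n
    have "5 * n \<noteq> k" using False by auto
    thus "sect (fls_X powi k :: complex fls) $$ n = 0 $$ n" by (simp add: fls_X_power_int)
  qed
  thus ?thesis using False by (simp add: sect_mult_dil)
qed

text \<open>The Hecke relation at 5. Divisors of 5n are the divisors of n together with their
  multiples by 5, and the overlap is 5 times the divisors of n/5.\<close>

lemma divisor_sum_5:
  assumes "n > 0"
  shows "(\<Sum>d | d dvd 5 * n. d) + (if 5 dvd n then 5 * (\<Sum>d | d dvd n div 5. d) else 0) = 6 * (\<Sum>d | d dvd n. d :: nat)"
proof -
  let ?D = "{d. d dvd n}" and ?M = "(\<lambda>d. 5 * d) ` {d. d dvd n}"
  have fin: "finite ?D" using assms by simp
  have "{d. d dvd 5 * n} = ?D \<union> ?M"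
  proof (intro equalityI subsetI)
    fix d assume d: "d \<in> {d. d dvd 5 * n}"
    show "d \<in> ?D \<union> ?M"
    proof (cases "5 dvd d")
      case True
      then obtain e where "d = 5 * e" by blast
      thus ?thesis using d by auto
    next
      case False
      have "prime (5 :: nat)" by simp
      from prime_imp_coprime[OF this False] have "coprime d 5" by (simp add: coprime_commute)
      thus ?thesis using d by (simp add: coprime_dvd_mult_right_iff)
    qed
  qed auto
  moreover have "?D \<inter> ?M = (if 5 dvd n then (\<lambda>d. 5 * d) ` {d. d dvd n div 5} else {})"
    by (auto elim: dvd_mult_left)
  moreover have "sum id (?D \<union> ?M) + sum id (?D \<inter> ?M) = sum id ?D + sum id ?M"
    using fin by (intro sum.union_inter) auto
  ultimately have "(\<Sum>d | d dvd 5 * n. d) + sum id (if 5 dvd n then (\<lambda>d. 5 * d) ` {d. d dvd n div 5} else {}) =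
     (\<Sum>d\<in>?D. d) + (\<Sum>d\<in>?M. d)"
    by simp
  moreover have "sum id ((\<lambda>d. 5 * d) ` A) = 5 * \<Sum>A" for A :: "nat set"
    by (subst sum.reindex) (auto simp: inj_on_def sum_distrib_left)
  ultimately show ?thesis by (auto split: if_splits)
qed

lemma sect_lambert_1: "sect (lambert 1) = 6 * lambert 1 - 5 * dil (lambert 1)"
proof (rule fls_eqI)
  fix n :: int
  have num: "(numeral k * F) $$ n = numeral k * F $$ n" for k and F :: "complex fls"
    by (metis fls_const_numeral fls_mult_const_nth(1))
  show "sect (lambert 1) $$ n = (6 * lambert 1 - 5 * dil (lambert 1)) $$ n"
  proof (cases "n > 0")
    case True
    then obtain m where m: "n = int m" "m > 0" by (metis pos_int_cases)
    have 1: "nat (5 * n) = 5 * m" using m by (simp add: nat_mult_distrib)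
    have 2: "nat (int m div 5) = m div 5" by (simp add: nat_div_distrib)
    have 3: "int m div 5 > 0 \<longleftrightarrow> m div 5 > 0" "5 dvd int m \<longleftrightarrow> 5 dvd m" by (presburger, metis int_dvd_int_iff of_nat_numeral)
    have 4: "m div 5 > 0" if "5 dvd m" using that m by auto
    show ?thesis
      using arg_cong[OF divisor_sum_5[OF m(2)], of "of_nat :: nat \<Rightarrow> complex"] m(2) 4
      unfolding fls_minus_nth num sect_nth dil_nth lambert_nth 1 unfolding m
      by (auto simp: 1 2 3 algebra_simps)
  next
    case False
    thus ?thesis
      unfolding fls_minus_nth num sect_nth dil_nth lambert_nth by auto
  qed
qed

text \<open>If \<open>R(q)\<close> denotes the Rogers--Ramanujan continued fraction, then \<open>rr\<close> is \<open>R(q\<^sup>5)\<close> and \<open>rr5\<close> is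
  \<open>R(q)\<^sup>5\<close>; only the dissection of \<open>euler\<close> is used.\<close>

definition rr_unit :: "complex fls" where
  "rr_unit = sect euler / dil euler"

definition rr :: "complex fls" where
  "rr = fls_X / dil rr_unit"

definition rr5 :: "complex fls" where
  "rr5 = fls_X / rr_unit ^ 5"

lemma unit1_rr_unit: "unit1 rr_unit"
  unfolding rr_unit_def by (intro unit1_divide unit1_dil unit1_euler unit1_sect_euler)

lemma rr_nonzero [simp]: "rr_unit \<noteq> 0" "rr \<noteq> 0" "rr5 \<noteq> 0"
  using unit1_nonzero[OF unit1_rr_unit] by (simp_all add: rr_def rr5_def)

lemma rr_power_5: "rr ^ 5 = dil rr5"
  by (simp add: rr_def rr5_def power_divide)

text \<open>The dissection divided by q V V E: its first term is 1/r, and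
  \<open>sect_euler_mult\<close> makes the third one -r.\<close>

lemma eta_ratio_rr: "eta_ratio = 1 / rr - 1 - rr"
proof -
  define a where "a = sect euler"
  define e where "e = dil euler"
  define c where "c = sect (euler / fls_X ^ 2)"
  have nz: "a \<noteq> 0" "e \<noteq> 0"
    unfolding a_def e_def using unit1_nonzero[OF unit1_sect_euler] by auto
  have "a * c = - (e ^ 2)" unfolding a_def c_def e_def by (rule sect_euler_mult)
  hence c: "c = - (e ^ 2) / a" using nz by (simp add: field_simps)
  have "euler = dil a - fls_X * dil e + fls_X ^ 2 * dil c"
    unfolding a_def c_def e_def by (rule euler_dissection)
  thus ?thesis
    unfolding eta_ratio_def rr_def rr_unit_def a_def[symmetric] e_def[symmetric] c
    using nz by (simp add: field_simps power2_eq_square)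
qed

lemma rr_powi: "rr powi k = fls_X powi k * dil (rr_unit powi (- k))"
  by (simp add: rr_def power_int_divide_distrib power_int_minus field_simps)

lemma sect_rr_powi: "sect (rr powi k) = (if 5 dvd k then rr5 powi (k div 5) else 0)"
proof (cases "5 dvd k")
  case True
  then obtain j where j: "k = 5 * j" by blast
  have "rr powi k = dil (rr5 powi j)"
    unfolding j dil_powi power_int_mult by (simp add: rr_power_5)
  thus ?thesis using j by (simp only: sect_dil) simp
next
  case False
  thus ?thesis unfolding rr_powi sect_X_powi_dil by (simp only: if_False)
qed

lemma sect_rr_powers:
  "sect rr = 0" "sect (rr ^ 2) = 0" "sect (rr ^ 3) = 0" "sect (rr ^ 4) = 0" "sect (rr ^ 5) = rr5"
  "sect (1 / rr) = 0" "sect (1 / rr ^ 2) = 0" "sect (1 / rr ^ 3) = 0" "sect (1 / rr ^ 4) = 0"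
  "sect (1 / rr ^ 5) = 1 / rr5" "sect (1 :: complex fls) = 1"
  using sect_rr_powi[of 1] sect_rr_powi[of 2] sect_rr_powi[of 3] sect_rr_powi[of 4] sect_rr_powi[of 5]
    sect_rr_powi[of "-1"] sect_rr_powi[of "-2"] sect_rr_powi[of "-3"] sect_rr_powi[of "-4"] sect_rr_powi[of "-5"]
    sect_dil[of "1 :: complex fls"]
  by (simp_all add: power_int_minus inverse_eq_divide)

lemma sect_numeral [simp]: "sect (numeral k) = (numeral k :: complex fls)"
  using sect_dil[of "numeral k :: complex fls"] by simp

text \<open>U kills every r^k with k not divisible by 5, so for exponents up to 4 only the term free
  of r survives.\<close>

lemma sect_eta_ratio_powers:
  "sect eta_ratio = -1" "sect (eta_ratio ^ 2) = -1" "sect (eta_ratio ^ 3) = 5" "sect (eta_ratio ^ 4) = -5"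
proof -
  have 2: "eta_ratio ^ 2 = 1 / rr ^ 2 - 2 * (1 / rr) - 1 + 2 * rr + rr ^ 2"
    unfolding eta_ratio_rr by (simp add: field_simps power2_eq_square)
  have 3: "eta_ratio ^ 3 = 1 / rr ^ 3 - 3 * (1 / rr ^ 2) + 5 - 3 * rr ^ 2 - rr ^ 3"
    unfolding eta_ratio_rr by (simp add: field_simps power2_eq_square power3_eq_cube)
  have "eta_ratio ^ 4 = (eta_ratio ^ 2) ^ 2" by simp
  also have "\<dots> = 1 / rr ^ 4 - 4 * (1 / rr ^ 3) + 2 * (1 / rr ^ 2) + 8 * (1 / rr) - 5 - 8 * rr + 2 * rr ^ 2 + 4 * rr ^ 3 + rr ^ 4"
    unfolding 2 by (simp add: field_simps) Groebner_Basis.algebra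
  finally have 4: "eta_ratio ^ 4 = \<dots>" .
  show "sect eta_ratio = -1" unfolding eta_ratio_rr by (simp add: sect_rr_powers)
  show "sect (eta_ratio ^ 2) = -1" unfolding 2 by (simp only: sect_add sect_diff sect_const_mult sect_rr_powers) simp
  show "sect (eta_ratio ^ 3) = 5" unfolding 3
    by (simp only: sect_add sect_diff sect_const_mult sect_rr_powers sect_numeral) simp
  show "sect (eta_ratio ^ 4) = -5" unfolding 4
    by (simp only: sect_add sect_diff sect_const_mult sect_rr_powers sect_numeral) simp
qed

text \<open>With t = 1/r - r one has 1/r^5 - r^5 = t^5 + 5 t^3 + 5 t. Here t = Y + 1, and 11 is the
  value at t = 1, that is at Y = 0.\<close>

lemma kpoly_eta_ratio_rr5: "eta_ratio * kpoly eta_ratio = dil (1 / rr5 - 11 - rr5)"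
proof -
  define s where "s = 1 / rr"
  have s: "s * rr = 1" by (simp add: s_def)
  have "eta_ratio * kpoly eta_ratio = s ^ 5 - 11 - rr ^ 5"
    unfolding eta_ratio_rr kpoly_def s_def[symmetric] using s by Groebner_Basis.algebra
  thus ?thesis by (simp add: s_def power_divide rr_power_5)
qed

text \<open>The factor 5 from differentiating a V-image matches the exponent 5 in
  \<open>rr5\<close>.\<close>

lemma logder_rr: "logder rr = dil (logder rr5)"
proof -
  have "logder rr5 = 1 - 5 * logder rr_unit"
    unfolding rr5_def by (subst logder_divide) (simp_all add: logder_power)
  thus ?thesis
    unfolding rr_def by (subst logder_divide) (simp_all add: logder_dil)
qed

lemma qderiv_eta_ratio: "qderiv eta_ratio = - (1 / rr + rr) * dil (logder rr5)"
proof -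
  have "qderiv rr = rr * dil (logder rr5)"
    by (simp add: qderiv_conv_logder logder_rr)
  moreover from this have "qderiv (1 / rr) = - (1 / rr) * dil (logder rr5)"
    using qderiv_mult[of rr "1 / rr"] by (simp add: field_simps eq_neg_iff_add_eq_0)
  ultimately show ?thesis unfolding eta_ratio_rr by (simp add: algebra_simps)
qed

lemma logder_eta_ratio: "logder eta_ratio = - lambert 1 - 1 + 25 * dil (dil (lambert 1))"
  unfolding eta_ratio_def
  by (subst logder_divide, simp, simp, subst logder_mult)
     (simp_all add: logder_euler logder_dil)

lemma eis2_5_lambert: "eis2_5 = 1 + 6 * lambert 1 - 30 * dil (lambert 1)"
  by (simp add: eis2_5_def eis2_def field_simps)

lemma logder_hauptmodul: "logder hauptmodul = eis2_5"
  unfolding hauptmodul_def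
  by (subst logder_divide, simp, simp, subst logder_mult)
     (simp_all add: logder_power logder_euler logder_dil eis2_5_lambert)

text \<open>The product has derivative 0. Write m for the bracket and z for \<open>eis2_5\<close> =
  \<open>logder hauptmodul\<close>. By the Hecke relation U maps \<open>logder eta_ratio\<close> to
  -z, hence -z m is U of \<open>logder eta_ratio * dil m\<close> =
  \<open>qderiv eta_ratio * kpoly eta_ratio\<close>. As a polynomial in r and 1/r this can be
  evaluated, and it turns out to be \<open>qderiv m\<close>.\<close>

lemma hauptmodul_rr5: "hauptmodul * (1 / rr5 - 11 - rr5) = 1"
proof -
  define m where "m = 1 / rr5 - 11 - rr5"
  define l where "l = logder rr5"
  have "sect (logder eta_ratio) = - eis2_5"
    unfolding logder_eta_ratio
    by (simp only: sect_add sect_diff sect_uminus sect_const_mult sect_dil sect_lambert_1 sect_rr_powers eis2_5_lambert) simp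
  hence "- eis2_5 * m = sect (logder eta_ratio * dil m)"
    by (simp add: sect_mult_dil)
  also have "logder eta_ratio * dil m = qderiv eta_ratio * kpoly eta_ratio"
    unfolding m_def kpoly_eta_ratio_rr5[symmetric] by (simp add: logder_def)
  also have "\<dots> = - ((1 / rr + rr) * kpoly eta_ratio) * dil l"
    unfolding qderiv_eta_ratio l_def[symmetric] by Groebner_Basis.algebra
  also have "(1 / rr + rr) * kpoly eta_ratio = 1 / rr ^ 5 + 1 / rr ^ 4 + 3 * (1 / rr ^ 3) + 4 * (1 / rr ^ 2) + 7 * (1 / rr)
      + 7 * rr - 4 * rr ^ 2 + 3 * rr ^ 3 - rr ^ 4 + rr ^ 5"
  proof -
    define s where "s = 1 / rr"
    have s: "s * rr = 1" by (simp add: s_def)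
    have p: "1 / rr ^ k = s ^ k" for k by (simp add: s_def power_divide)
    show ?thesis
      unfolding eta_ratio_rr kpoly_def p s_def[symmetric] using s by Groebner_Basis.algebra
  qed
  also have "sect (- \<dots> * dil l) = - (1 / rr5 + rr5) * l"
    unfolding sect_mult_dil
    by (simp only: sect_add sect_diff sect_uminus sect_const_mult sect_rr_powers) simp
  finally have z: "eis2_5 * m = (1 / rr5 + rr5) * l" by Groebner_Basis.algebra
  have "qderiv rr5 = rr5 * l" by (simp add: qderiv_conv_logder l_def)
  moreover from this have "qderiv (1 / rr5) = - (1 / rr5) * l"
    using qderiv_mult[of rr5 "1 / rr5"] by (simp add: field_simps eq_neg_iff_add_eq_0)
  ultimately have "qderiv m = - (1 / rr5 + rr5) * l"
    unfolding m_def by (simp add: algebra_simps)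
  hence "qderiv (hauptmodul * m) = 0"
    unfolding qderiv_mult qderiv_conv_logder[OF eta_nonzero(2)] logder_hauptmodul using z by Groebner_Basis.algebra
  hence "hauptmodul * m = fls_const ((hauptmodul * m) $$ 0)"
    by (rule qderiv_eq_0_imp_const)
  moreover have "unit1 (hauptmodul * m)"
  proof -
    define u where "u = dil euler ^ 6 / euler ^ 6"
    have u: "unit1 u" unfolding u_def by (intro unit1_divide unit1_power unit1_dil unit1_euler)
    have eq: "hauptmodul * m = u * (rr_unit ^ 5) + (- (fls_X ^ 1 * (u * (11 + fls_X * inverse (rr_unit ^ 5)))))"
      by (simp add: hauptmodul_def u_def m_def rr5_def field_simps)
    have "vanish (int 1 + (0 + 0)) (fls_X ^ 1 * (u * (11 + fls_X * inverse (rr_unit ^ 5))))"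
    proof (intro vanish_mult vanish_X_power vanish_add unit1_imp_vanish[OF u] vanish_of_nat)
      have "vanish (int 1 + 0) (fls_X ^ 1 * inverse (rr_unit ^ 5))"
        by (intro vanish_mult vanish_X_power unit1_imp_vanish unit1_inverse unit1_power unit1_rr_unit)
      thus "vanish 0 (fls_X * inverse (rr_unit ^ 5))" by (auto elim: vanish_mono)
    qed
    hence "vanish 1 (- (fls_X ^ 1 * (u * (11 + fls_X * inverse (rr_unit ^ 5)))))"
      by (simp add: vanish_def)
    thus ?thesis unfolding eq
      by (intro unit1_add_vanish unit1_mult unit1_power u unit1_rr_unit)
  qed
  ultimately show ?thesis unfolding m_def unit1_iff by (metis fls_const_1)
qed

lemma dil_hauptmodul: "dil hauptmodul * (eta_ratio * kpoly eta_ratio) = 1"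
  unfolding kpoly_eta_ratio_rr5 by (simp only: dil_simps(6)[symmetric] hauptmodul_rr5 dil_simps(2))

lemma hauptmodul_mult_dil: "hauptmodul * dil hauptmodul * eta_ratio ^ 6 = 1"
  unfolding hauptmodul_def eta_ratio_def by (simp add: field_simps) Groebner_Basis.algebra

lemma kpoly_nonzero: "kpoly eta_ratio \<noteq> 0"
  using dil_hauptmodul by auto

lemma hauptmodul_kpoly: "hauptmodul = kpoly eta_ratio / eta_ratio ^ 5"
proof -
  have "hauptmodul * eta_ratio ^ 6 = eta_ratio * kpoly eta_ratio"
    using hauptmodul_mult_dil dil_hauptmodul by Groebner_Basis.algebra
  hence "eta_ratio * (hauptmodul * eta_ratio ^ 5 - kpoly eta_ratio) = 0"
    by Groebner_Basis.algebra
  thus ?thesis by (simp add: field_simps)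
qed

lemma dil_hauptmodul_kpoly: "dil hauptmodul = 1 / (eta_ratio * kpoly eta_ratio)"
  using dil_hauptmodul kpoly_nonzero by (simp add: field_simps)

lemma eta_quot_kpoly: "eta_quot * kpoly eta_ratio = eta_ratio ^ 4 * dil eta_quot"
proof -
  have "eta_quot = eta_ratio ^ 5 * dil hauptmodul * dil eta_quot"
    unfolding eta_quot_def eta_ratio_def hauptmodul_def by (simp add: field_simps) Groebner_Basis.algebra
  hence "eta_quot * (eta_ratio * kpoly eta_ratio) = eta_ratio ^ 5 * dil eta_quot"
    unfolding dil_hauptmodul_kpoly using kpoly_nonzero by (simp add: field_simps)
  hence "eta_ratio * (eta_quot * kpoly eta_ratio - eta_ratio ^ 4 * dil eta_quot) = 0"
    by Groebner_Basis.algebra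
  thus ?thesis by simp
qed

section \<open>Quadratic relation for the weight two Eisenstein series of level five\<close>

lemma unit1_eis2_5: "unit1 eis2_5"
proof -
  have "vanish 1 (dil (lambert 1))" by (auto simp: vanish_def dil_nth lambert_nth)
  hence "vanish (0 + 1) (6 * lambert 1)" "vanish (0 + 1) (30 * dil (lambert 1))"
    by (intro vanish_mult vanish_lambert vanish_of_nat; simp)+
  hence "unit1 (1 + (6 * lambert 1 - 30 * dil (lambert 1)))"
    by (intro unit1_add_vanish vanish_diff unit1_1) simp_all
  thus ?thesis unfolding eis2_5_lambert by (simp only: add_diff_eq)
qed

lemma eis2_5_nonzero [simp]: "eis2_5 \<noteq> 0"
  using unit1_nonzero[OF unit1_eis2_5] .

lemma unit1_eta_quot: "unit1 eta_quot"
  unfolding eta_quot_def by (intro unit1_divide unit1_power unit1_dil unit1_euler)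

lemma vanish_hauptmodul: "vanish 1 hauptmodul"
proof -
  have "vanish (int 1 + 0) (fls_X ^ 1 * (dil euler ^ 6 / euler ^ 6) :: complex fls)"
    by (intro vanish_mult vanish_X_power unit1_imp_vanish unit1_divide unit1_power unit1_dil unit1_euler)
  thus ?thesis by (simp add: hauptmodul_def)
qed

lemma unit1_hauptmodul_poly: "unit1 (1 + numeral i * hauptmodul + numeral j * hauptmodul ^ 2)"
proof -
  have h0: "vanish 0 hauptmodul" by (rule vanish_mono[OF vanish_hauptmodul]) simp
  have "vanish (0 + 1) (numeral i * hauptmodul)" "vanish (0 + (0 + 1)) (numeral j * (hauptmodul * hauptmodul))"
    by (intro vanish_mult vanish_of_nat vanish_hauptmodul h0)+
  hence "unit1 (1 + (numeral i * hauptmodul + numeral j * hauptmodul ^ 2))"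
    by (intro unit1_add_vanish vanish_add unit1_1) (simp_all add: power2_eq_square)
  thus ?thesis by (simp add: add.assoc)
qed

lemma qderiv_eta_ratio_power: "qderiv (eta_ratio ^ n) = of_nat n * eta_ratio ^ n * logder eta_ratio"
  by (simp add: qderiv_conv_logder logder_power)

text \<open>Logarithmic derivatives of \<open>dil_hauptmodul\<close> and
  \<open>hauptmodul_mult_dil\<close> give two linear relations between z, V z and
  \<open>logder eta_ratio\<close>; the last is eliminated.\<close>

lemma dil_eis2_5:
  "dil eis2_5 * (eta_ratio ^ 4 + 10 * eta_ratio ^ 3 + 45 * eta_ratio ^ 2 + 100 * eta_ratio + 125) =
   eis2_5 * (eta_ratio ^ 4 + 4 * eta_ratio ^ 3 + 9 * eta_ratio ^ 2 + 10 * eta_ratio + 5)"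
proof -
  define Y where "Y = eta_ratio"
  define l where "l = logder Y"
  define K where "K = Y * kpoly Y"
  define h1 where "h1 = dil hauptmodul"
  have Y: "Y \<noteq> 0" by (simp add: Y_def)
  have p: "qderiv (Y ^ n) = of_nat n * Y ^ n * l" for n
    unfolding Y_def l_def by (rule qderiv_eta_ratio_power)
  have K: "K = Y ^ 5 + 5 * Y ^ 4 + 15 * Y ^ 3 + 25 * Y ^ 2 + 25 * Y ^ 1"
    unfolding K_def kpoly_def by Groebner_Basis.algebra
  have dK: "qderiv K = (5 * Y ^ 5 + 20 * Y ^ 4 + 45 * Y ^ 3 + 50 * Y ^ 2 + 25 * Y) * l"
    unfolding K by (simp only: qderiv_simps p) (simp add: algebra_simps)
  have h1K: "h1 * K = 1" unfolding h1_def K_def Y_def by (rule dil_hauptmodul)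
  have "qderiv h1 = h1 * (5 * dil eis2_5)"
    by (simp add: h1_def qderiv_conv_logder logder_dil logder_hauptmodul)
  hence "h1 * (5 * dil eis2_5) * K + h1 * qderiv K = 0"
    using arg_cong[OF h1K, of qderiv] by (simp add: qderiv_mult)
  hence 1: "5 * dil eis2_5 * K + qderiv K = 0"
    using h1K by Groebner_Basis.algebra
  have "logder (hauptmodul * dil hauptmodul * eta_ratio ^ 6) = 0"
    unfolding hauptmodul_mult_dil by (simp add: logder_def)
  hence 2: "6 * l = - (eis2_5 + 5 * dil eis2_5)"
    by (simp add: logder_mult logder_power logder_dil logder_hauptmodul l_def Y_def algebra_simps eq_neg_iff_add_eq_0)
  have "Y * (30 * (dil eis2_5 * (Y ^ 4 + 10 * Y ^ 3 + 45 * Y ^ 2 + 100 * Y + 125) -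
          eis2_5 * (Y ^ 4 + 4 * Y ^ 3 + 9 * Y ^ 2 + 10 * Y + 5))) = 0"
    using 1[unfolded dK] 2 unfolding K by Groebner_Basis.algebra
  thus ?thesis using Y unfolding Y_def by simp
qed

lemma eta_ratio_kpoly_cancel:
  "eta_ratio ^ 10 * kpoly eta_ratio ^ 2 * F = eta_ratio ^ 10 * kpoly eta_ratio ^ 2 * G \<Longrightarrow> F = G"
  using kpoly_nonzero by simp

text \<open>The quadratic is h^2 (1/x + x)^2 with x = \<open>rr5\<close>: since 1/x - x = 1/h + 11,
  the square is (1/h + 11)^2 + 4. The quotient \<open>psi\<close> of the two sides is fixed by V,
  hence constant, and its constant term is 1.\<close>

lemma eis2_5_square: "eis2_5 ^ 2 = eta_quot ^ 2 * (1 + 22 * hauptmodul + 125 * hauptmodul ^ 2)"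
proof -
  define Y where "Y = eta_ratio"
  define k where "k = kpoly Y"
  define h where "h = hauptmodul"
  define h1 where "h1 = dil hauptmodul"
  define w where "w = eta_quot"
  define w1 where "w1 = dil eta_quot"
  define z where "z = eis2_5"
  define z1 where "z1 = dil eis2_5"
  \<comment> \<open>\<open>a\<close> is (1/r^5 + r^5) / (1/r + r) written in Y, and \<open>b\<close>
    is its reflection: 5 b(Y) = Y^4 a(5/Y). The common factor \<open>Y ^ 2 + 2 * Y + 5\<close> below
    is (1/r + r)^2; it cancels in the comparison.\<close>
  define a where "a = Y ^ 4 + 4 * Y ^ 3 + 9 * Y ^ 2 + 10 * Y + 5"
  define b where "b = Y ^ 4 + 10 * Y ^ 3 + 45 * Y ^ 2 + 100 * Y + 125"
  define g where "g = 1 + 22 * h + 125 * h ^ 2"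
  define g1 where "g1 = 1 + 22 * h1 + 125 * h1 ^ 2"
  have nz: "Y \<noteq> 0" "k \<noteq> 0" "w \<noteq> 0" "w1 \<noteq> 0" "g \<noteq> 0" "g1 \<noteq> 0" "z \<noteq> 0" "z1 \<noteq> 0"
  proof -
    show g: "g \<noteq> 0" unfolding g_def h_def by (rule unit1_nonzero[OF unit1_hauptmodul_poly])
    have "g1 = dil g" by (simp add: g_def g1_def h_def h1_def)
    thus "g1 \<noteq> 0" using g by simp
  qed (simp_all add: Y_def k_def w_def w1_def z_def z1_def kpoly_nonzero)
  have z1: "z1 * b = z * a" unfolding z1_def z_def a_def b_def Y_def by (rule dil_eis2_5)
  have w1: "w * k = Y ^ 4 * w1" unfolding w_def w1_def k_def Y_def by (rule eta_quot_kpoly)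
  have h: "h * Y ^ 5 = k" unfolding h_def k_def Y_def hauptmodul_kpoly by simp
  have h1: "h1 * (Y * k) = 1" unfolding h1_def k_def Y_def by (rule dil_hauptmodul)
  have g: "g * Y ^ 10 = (Y ^ 2 + 2 * Y + 5) * b ^ 2"
  proof -
    have "g * Y ^ 10 = Y ^ 10 + 22 * k * Y ^ 5 + 125 * k ^ 2"
      unfolding g_def h[symmetric] by Groebner_Basis.algebra
    also have "\<dots> = (Y ^ 2 + 2 * Y + 5) * b ^ 2" unfolding k_def kpoly_def b_def by Groebner_Basis.algebra
    finally show ?thesis .
  qed
  have g1: "g1 * (Y * k) ^ 2 = (Y ^ 2 + 2 * Y + 5) * a ^ 2"
  proof -
    have "g1 * (Y * k) ^ 2 = (Y * k) ^ 2 + 22 * (Y * k) * (h1 * (Y * k)) + 125 * (h1 * (Y * k)) ^ 2"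
      unfolding g1_def by Groebner_Basis.algebra
    also have "\<dots> = (Y * k) ^ 2 + 22 * (Y * k) + 125" unfolding h1 by simp
    also have "\<dots> = (Y ^ 2 + 2 * Y + 5) * a ^ 2" unfolding k_def kpoly_def a_def by Groebner_Basis.algebra
    finally show ?thesis .
  qed
  have b: "b \<noteq> 0" using g nz by auto
  have "Y ^ 10 * k ^ 2 * (b ^ 2 * (z1 ^ 2 * (w ^ 2 * g))) = (z1 * b) ^ 2 * (w * k) ^ 2 * (g * Y ^ 10)"
    by Groebner_Basis.algebra
  also have "\<dots> = (z * a) ^ 2 * (Y ^ 4 * w1) ^ 2 * ((Y ^ 2 + 2 * Y + 5) * b ^ 2)"
    unfolding z1 w1 g ..
  also have "\<dots> = Y ^ 8 * (b ^ 2 * z ^ 2 * w1 ^ 2) * ((Y ^ 2 + 2 * Y + 5) * a ^ 2)"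
    by Groebner_Basis.algebra
  also have "\<dots> = Y ^ 10 * k ^ 2 * (b ^ 2 * (z ^ 2 * (w1 ^ 2 * g1)))"
    unfolding g1[symmetric] by Groebner_Basis.algebra
  finally have "z1 ^ 2 * (w ^ 2 * g) = z ^ 2 * (w1 ^ 2 * g1)"
    using nz b by simp
  hence eq: "z ^ 2 / (w ^ 2 * g) = z1 ^ 2 / (w1 ^ 2 * g1)"
    using nz by (simp add: field_simps)
  define psi where "psi = z ^ 2 / (w ^ 2 * g)"
  have "dil psi = z1 ^ 2 / (w1 ^ 2 * g1)"
    by (simp add: psi_def z_def w_def g_def h_def z1_def w1_def g1_def h1_def)
  hence "psi = fls_const 1 * dil psi"
    using eq by (simp add: psi_def)
  hence "psi = fls_const (psi $$ 0)" by (rule dil_fixed_imp_const)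
  moreover have "unit1 psi"
    unfolding psi_def z_def w_def g_def h_def
    by (intro unit1_divide unit1_mult unit1_power unit1_eis2_5 unit1_eta_quot unit1_hauptmodul_poly)
  ultimately have "psi = 1" by (metis fls_const_1 unit1_iff)
  thus ?thesis using nz unfolding psi_def by (simp add: z_def w_def g_def h_def field_simps)
qed

section \<open>Ramanujan's convolution identity\<close>

text \<open>Each quadruple is a splitting of n into ax and by with a chosen divisor of each part, so
  summing ab yields the convolution of sigma_1 with itself.\<close>

definition quads :: "nat \<Rightarrow> (nat \<times> nat \<times> nat \<times> nat) set" where
  "quads n = {(a, b, x, y). a > 0 \<and> b > 0 \<and> x > 0 \<and> y > 0 \<and> a * x + b * y = n}"

lemma finite_quads [simp]: "finite (quads n)"
proof (rule finite_subset)
  have le: "u \<le> n \<and> v \<le> n" if "u > 0" "v > 0" "u * v \<le> n" for u v :: nat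
  proof -
    have "u * 1 \<le> u * v" "1 * v \<le> u * v"
      using that by (intro mult_le_mono; simp)+
    thus ?thesis using that(3) by linarith
  qed
  show "quads n \<subseteq> {..n} \<times> {..n} \<times> {..n} \<times> {..n}"
  proof
    fix q assume "q \<in> quads n"
    then obtain a b x y where q: "q = (a, b, x, y)" "a > 0" "b > 0" "x > 0" "y > 0" "a * x + b * y = n"
      by (auto simp: quads_def)
    thus "q \<in> {..n} \<times> {..n} \<times> {..n} \<times> {..n}"
      using le[of a x] le[of b y] by auto
  qed
qed simp

definition quad_sum :: "nat \<Rightarrow> (nat \<Rightarrow> nat \<Rightarrow> nat \<Rightarrow> nat \<Rightarrow> bool) \<Rightarrow> (nat \<Rightarrow> nat \<Rightarrow> int) \<Rightarrow> int" where
  "quad_sum n P g = (\<Sum>(a, b, x, y) \<in> {(a, b, x, y) \<in> quads n. P a b x y}. g a b)"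

lemma finite_quads_filter [simp]: "finite {(a, b, x, y) \<in> quads n. P a b x y}"
  by (rule finite_subset[OF _ finite_quads[of n]]) auto

lemma quad_sum_split:
  assumes "\<And>a b x y. Q a b x y \<longleftrightarrow> P a b x y \<or> R a b x y" "\<And>a b x y. \<not> (P a b x y \<and> R a b x y)"
  shows "quad_sum n Q g = quad_sum n P g + quad_sum n R g"
  unfolding quad_sum_def
  by (subst sum.union_disjoint[symmetric]) (use assms in \<open>auto intro!: sum.cong\<close>)

lemma quad_sum_trichotomy_xy:
  "quad_sum n (\<lambda>a b x y. True) g = quad_sum n (\<lambda>a b x y. x > y) g + 
     quad_sum n (\<lambda>a b x y. x < y) g + quad_sum n (\<lambda>a b x y. x = y) g"
  by (subst quad_sum_split[of _ "\<lambda>a b x y. x \<noteq> y" "\<lambda>a b x y. x = y"], simp, simp,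
      subst quad_sum_split[of _ "\<lambda>a b x y. x > y" "\<lambda>a b x y. x < y"]) auto

lemma quad_sum_trichotomy_ab:
  "quad_sum n (\<lambda>a b x y. True) g = quad_sum n (\<lambda>a b x y. a < b) g + 
     quad_sum n (\<lambda>a b x y. a > b) g + quad_sum n (\<lambda>a b x y. a = b) g"
  by (subst quad_sum_split[of _ "\<lambda>a b x y. a \<noteq> b" "\<lambda>a b x y. a = b"], simp, simp,
      subst quad_sum_split[of _ "\<lambda>a b x y. a < b" "\<lambda>a b x y. a > b"]) auto

lemma quad_sum_swap: "quad_sum n P g = quad_sum n (\<lambda>a b x y. P b a y x) (\<lambda>a b. g b a)"
  unfolding quad_sum_def
  by (rule sum.reindex_bij_witness[of _ "\<lambda>(a, b, x, y). (b, a, y, x)" "\<lambda>(a, b, x, y). (b, a, y, x)"])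
     (auto simp: quads_def)

text \<open>The bijection comes from ax + by = a (x - y) + (a + b) y.\<close>

lemma quad_sum_shift_b:
  "quad_sum n (\<lambda>a b x y. x > y) g = quad_sum n (\<lambda>a b x y. a < b) (\<lambda>a b. g a (b - a))"
  unfolding quad_sum_def
  by (rule sum.reindex_bij_witness[of _ "\<lambda>(a, b, x, y). (a, b - a, x + y, y)" "\<lambda>(a, b, x, y). (a, a + b, x - y, y)"])
     (auto simp: quads_def algebra_simps diff_mult_distrib diff_mult_distrib2 trans_le_add1)

lemma quad_sum_shift_a:
  "quad_sum n (\<lambda>a b x y. x < y) g = quad_sum n (\<lambda>a b x y. a > b) (\<lambda>a b. g (a - b) b)"
  unfolding quad_sum_def
  by (rule sum.reindex_bij_witness[of _ "\<lambda>(a, b, x, y). (a - b, b, x, x + y)" "\<lambda>(a, b, x, y). (a + b, b, x, y - x)"])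
     (auto simp: quads_def algebra_simps diff_mult_distrib diff_mult_distrib2 trans_le_add1)

lemma quad_sum_cong:
  "(\<And>a b x y. P a b x y \<Longrightarrow> g a b = h a b) \<Longrightarrow> quad_sum n P g = quad_sum n P h"
  unfolding quad_sum_def by (intro sum.cong) auto

lemma quad_sum_add: "quad_sum n P (\<lambda>a b. g a b + h a b) = quad_sum n P g + quad_sum n P h"
  unfolding quad_sum_def by (simp add: sum.distrib[symmetric] case_prod_unfold)

lemma quad_sum_mult: "quad_sum n P (\<lambda>a b. c * g a b) = c * quad_sum n P g"
  unfolding quad_sum_def by (simp add: sum_distrib_left case_prod_unfold)

text \<open>Start from 4ab = (a+b)^2 - (a-b)^2. The shifts turn the off-diagonal parts of both
  squares into sums of b^2 over a < b and over x > y. Splitting the full sum of b^2 by x, y and by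
  a, b compares these two, and only the diagonals x = y and a = b remain.\<close>

lemma quad_sum_diagonal:
  "4 * quad_sum n (\<lambda>a b x y. True) (\<lambda>a b. int a * int b) =
     quad_sum n (\<lambda>a b x y. x = y) (\<lambda>a b. 2 * int b ^ 2 + int (a + b) ^ 2) -
     2 * quad_sum n (\<lambda>a b x y. a = b) (\<lambda>a b. int b ^ 2)"
proof -
  let ?T = "\<lambda>a b x y::nat. True" and ?sq = "\<lambda>a b. int b ^ 2"
  let ?p = "\<lambda>a b. int (a + b) ^ 2" and ?m = "\<lambda>a b. (int a - int b) ^ 2"
  have 1: "quad_sum n ?T ?p = quad_sum n ?T (\<lambda>a b. 4 * (int a * int b)) + quad_sum n ?T ?m"
    unfolding quad_sum_add[symmetric] by (rule quad_sum_cong) (simp add: power2_eq_square algebra_simps)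
  have 2: "quad_sum n ?T ?p = 2 * quad_sum n (\<lambda>a b x y. a < b) ?sq + quad_sum n (\<lambda>a b x y. x = y) ?p"
  proof -
    have "quad_sum n (\<lambda>a b x y. x < y) ?p = quad_sum n (\<lambda>a b x y. x > y) ?p"
      by (subst quad_sum_swap) (simp add: add.commute)
    moreover have "quad_sum n (\<lambda>a b x y. x > y) ?p = quad_sum n (\<lambda>a b x y. a < b) ?sq"
      unfolding quad_sum_shift_b by (rule quad_sum_cong) simp
    ultimately show ?thesis by (simp add: quad_sum_trichotomy_xy)
  qed
  have 3: "quad_sum n ?T ?m = 2 * quad_sum n (\<lambda>a b x y. x > y) ?sq"
  proof -
    have "quad_sum n (\<lambda>a b x y. a > b) ?m = quad_sum n (\<lambda>a b x y. a < b) ?m"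
      by (subst quad_sum_swap) (simp add: power2_commute)
    moreover have "quad_sum n (\<lambda>a b x y. x > y) ?sq = quad_sum n (\<lambda>a b x y. a < b) ?m"
      unfolding quad_sum_shift_b by (rule quad_sum_cong) (simp add: of_nat_diff power2_commute)
    moreover have "quad_sum n (\<lambda>a b x y. a = b) ?m = 0"
      unfolding quad_sum_def by (intro sum.neutral) auto
    ultimately show ?thesis by (simp add: quad_sum_trichotomy_ab quad_sum_mult)
  qed
  have 4: "quad_sum n (\<lambda>a b x y. x < y) ?sq = quad_sum n (\<lambda>a b x y. a > b) ?sq"
    by (rule quad_sum_shift_a)
  show ?thesis
    using 1 2 3 4 quad_sum_trichotomy_xy[of n ?sq] quad_sum_trichotomy_ab[of n ?sq]
    unfolding quad_sum_add quad_sum_mult by linarith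
qed

lemma quad_sum_eq_xy:
  assumes "n > 0"
  shows "quad_sum n (\<lambda>a b x y. x = y) g = (\<Sum>d | d dvd n. \<Sum>b\<in>{1..<d}. g (d - b) b)"
proof -
  have aux: "(u * w + v * w) div (u + v) = w" "u + v dvd u * w + v * w" if "u > 0" for u v w :: nat
    using that unfolding add_mult_distrib[symmetric] by simp_all
  have "(\<Sum>d | d dvd n. \<Sum>b\<in>{1..<d}. g (d - b) b) = 
        (\<Sum>(d, b)\<in>Sigma {d. d dvd n} (\<lambda>d. {1..<d}). g (d - b) b)"
    using assms by (intro sum.Sigma) auto
  also have "\<dots> = quad_sum n (\<lambda>a b x y. x = y) g"
    unfolding quad_sum_def
    by (rule sum.reindex_bij_witness[of _ "\<lambda>(a, b, x, y). (a + b, b)" "\<lambda>(d, b). (d - b, b, n div d, n div d)"])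
       (use assms in \<open>auto simp: quads_def algebra_simps aux elim!: dvdE intro!: Nat.gr0I\<close>)
  finally show ?thesis ..
qed

lemma quad_sum_eq_ab:
  assumes "n > 0"
  shows "quad_sum n (\<lambda>a b x y. a = b) g = (\<Sum>d | d dvd n. int (n div d - 1) * g d d)"
proof -
  have "(\<Sum>d | d dvd n. int (n div d - 1) * g d d) = (\<Sum>d | d dvd n. \<Sum>y\<in>{1..<n div d}. g d d)"
    by simp
  also have "\<dots> = (\<Sum>(d, y)\<in>Sigma {d. d dvd n} (\<lambda>d. {1..<n div d}). g d d)"
    using assms by (intro sum.Sigma) auto
  also have "\<dots> = quad_sum n (\<lambda>a b x y. a = b) g"
    unfolding quad_sum_def
    by (rule sum.reindex_bij_witness[of _ "\<lambda>(a, b, x, y). (a, y)" "\<lambda>(d, y). (d, d, n div d - y, y)"])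
       (use assms in \<open>auto simp: quads_def algebra_simps elim!: dvdE intro!: Nat.gr0I\<close>)
  finally show ?thesis ..
qed

lemma sum_squares_below: "6 * (\<Sum>b\<in>{1..<Suc d}. int b ^ 2) = int d * (int d + 1) * (2 * int d + 1)"
proof (induction d)
  case (Suc d)
  have "{1..<Suc (Suc d)} = insert (Suc d) {1..<Suc d}" by auto
  thus ?case using Suc by (simp add: algebra_simps power2_eq_square)
qed simp

lemma quad_sum_eval:
  assumes "n > 0"
  shows "12 * quad_sum n (\<lambda>a b x y. True) (\<lambda>a b. int a * int b) =
    5 * (\<Sum>d | d dvd n. int d ^ 3) + (\<Sum>d | d dvd n. int d) - 6 * int n * (\<Sum>d | d dvd n. int d)"
proof -
  have "12 * quad_sum n (\<lambda>a b x y. True) (\<lambda>a b. int a * int b) = 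
     (\<Sum>d | d dvd n. 3 * (\<Sum>b\<in>{1..<d}. 2 * int b ^ 2 + int (d - b + b) ^ 2) - 6 * (int (n div d - 1) * int d ^ 2))"
    using quad_sum_diagonal[of n] assms
    by (simp only: quad_sum_eq_xy quad_sum_eq_ab sum_subtractf sum_distrib_left[symmetric])
  also have "\<dots> = (\<Sum>d | d dvd n. 5 * int d ^ 3 + int d - 6 * int n * int d)"
  proof (rule sum.cong)
    fix d assume "d \<in> {d. d dvd n}"
    then obtain c where c: "n = d * c" by auto
    with assms obtain e where e: "d = Suc e" "c > 0" by (cases d) auto
    have "3 * (\<Sum>b\<in>{1..<d}. 2 * int b ^ 2 + int (d - b + b) ^ 2) = 
            (\<Sum>b\<in>{1..<d}. 6 * int b ^ 2 + 3 * int d ^ 2)"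
      unfolding sum_distrib_left by (intro sum.cong) auto
    also have "\<dots> = 6 * (\<Sum>b\<in>{1..<Suc e}. int b ^ 2) + 3 * int e * int d ^ 2"
      using e by (simp add: sum.distrib sum_distrib_left)
    also have "\<dots> = int e * int d * (2 * int e + 1) + 3 * int e * int d ^ 2"
      unfolding sum_squares_below using e by simp
    finally have 1: "3 * (\<Sum>b\<in>{1..<d}. 2 * int b ^ 2 + int (d - b + b) ^ 2) = \<dots>" .
    have 2: "int (n div d - 1) = int c - 1" "int n = int d * int c" "int e = int d - 1"
    proof -
      have "d \<noteq> 0" using e by simp
      hence "n div d = c" unfolding c by (rule nonzero_mult_div_cancel_left)
      thus "int (n div d - 1) = int c - 1" using e by (simp add: of_nat_diff)
      show "int n = int d * int c" using c by simp
      show "int e = int d - 1" using e by simp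
    qed
    show "3 * (\<Sum>b\<in>{1..<d}. 2 * int b ^ 2 + int (d - b + b) ^ 2) - 6 * (int (n div d - 1) * int d ^ 2) =
          5 * int d ^ 3 + int d - 6 * int n * int d"
      unfolding 1 2 by Groebner_Basis.algebra
  qed simp
  finally show ?thesis by (simp add: sum.distrib sum_subtractf sum_distrib_left)
qed

lemma sigma_convolution:
  assumes "n > 0"
  shows "(\<Sum>k\<in>{1..<n}. (\<Sum>d | d dvd k. int d) * (\<Sum>d | d dvd (n - k). int d)) =
     quad_sum n (\<lambda>a b x y. True) (\<lambda>a b. int a * int b)"
proof -
  have "(\<Sum>k\<in>{1..<n}. (\<Sum>d | d dvd k. int d) * (\<Sum>d | d dvd (n - k). int d)) =
     (\<Sum>k\<in>{1..<n}. \<Sum>(a, b)\<in>{d. d dvd k} \<times> {d. d dvd (n - k)}. int a * int b)"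
    by (simp add: sum_product sum.cartesian_product)
  also have "\<dots> = (\<Sum>(k, a, b)\<in>Sigma {1..<n} (\<lambda>k. {d. d dvd k} \<times> {d. d dvd (n - k)}). int a * int b)"
    by (subst sum.Sigma) (auto simp: case_prod_unfold)
  also have "\<dots> = quad_sum n (\<lambda>a b x y. True) (\<lambda>a b. int a * int b)"
    unfolding quad_sum_def
  proof (rule sum.reindex_bij_witness[of _ "\<lambda>(a, b, x, y). (a * x, a, b)" "\<lambda>(k, a, b). (a, b, k div a, (n - k) div b)"], goal_cases)
    case (2 u)
    then obtain k a b where u: "u = (k, a, b)" "k > 0" "k < n" "a dvd k" "b dvd (n - k)" by auto
    from \<open>a dvd k\<close> obtain c where "k = a * c" by (rule dvdE)
    moreover from \<open>b dvd (n - k)\<close> obtain d where "n - k = b * d" by (rule dvdE)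
    ultimately
    show ?case using u by (auto simp: quads_def intro!: Nat.gr0I)
  next
    case (4 q)
    thus ?case by (auto simp: quads_def)
  qed (auto simp: quads_def)
  finally show ?thesis .
qed

lemma lambert_1_square: "12 * lambert 1 ^ 2 = 5 * lambert 3 + lambert 1 - 6 * qderiv (lambert 1)"
proof (rule fls_eqI)
  fix m :: int
  have num: "(numeral k * F) $$ n = numeral k * F $$ n" for k n and F :: "complex fls"
    by (metis fls_const_numeral fls_mult_const_nth(1))
  have sq: "(lambert 1 ^ 2) $$ m = (\<Sum>i=1..m-1. lambert 1 $$ i * lambert 1 $$ (m - i))"
    unfolding power2_eq_square by (rule fls_mult_nth_bounds) (auto simp: lambert_nth)
  show "(12 * lambert 1 ^ 2) $$ m = (5 * lambert 3 + lambert 1 - 6 * qderiv (lambert 1)) $$ m"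
  proof (cases "m > 0")
    case True
    then obtain n where n: "m = int n" "n > 0" by (metis pos_int_cases)
    have "(\<Sum>i=1..m-1. lambert 1 $$ i * lambert 1 $$ (m - i)) =
          (\<Sum>k\<in>{1..<n}. of_int ((\<Sum>d | d dvd k. int d) * (\<Sum>d | d dvd (n - k). int d)))"
      by (rule sum.reindex_bij_witness[of _ int nat]) (use n in \<open>auto simp: lambert_nth nat_diff_distrib\<close>)
    also have "\<dots> = of_int (quad_sum n (\<lambda>a b x y. True) (\<lambda>a b. int a * int b))"
      by (simp only: of_int_sum[symmetric] sigma_convolution[OF n(2)])
    finally have "(12 * lambert 1 ^ 2) $$ m = of_int (12 * quad_sum n (\<lambda>a b x y. True) (\<lambda>a b. int a * int b))"
      unfolding num sq by simp
    also have "\<dots> = (5 * lambert 3 + lambert 1 - 6 * qderiv (lambert 1)) $$ m"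
      unfolding quad_sum_eval[OF n(2)] fls_minus_nth fls_plus_nth num qderiv_nth lambert_nth using n by simp
    finally show ?thesis .
  next
    case False
    thus ?thesis unfolding fls_minus_nth fls_plus_nth num sq qderiv_nth lambert_nth by simp
  qed
qed


section \<open>The weight four Eisenstein series at level five\<close>

definition eis4 :: "complex fls" where
  "eis4 = 1 + 240 * lambert 3"

lemma eis4_eis2: "eis4 = eis2 ^ 2 - 12 * qderiv eis2"
proof -
  have "qderiv eis2 = - 24 * qderiv (lambert 1)"
    unfolding eis2_def by simp
  thus ?thesis
    unfolding eis4_def eis2_def using lambert_1_square by Groebner_Basis.algebra
qed

text \<open>Since 5 V P = P + 4z, the terms P^2 and \<open>qderiv P\<close> cancel and 48
  \<open>qderiv z\<close> - 8 P z - 16 z^2 is left. Differentiating \<open>eis2_5_square\<close>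
  gives \<open>qderiv z\<close>, and P = z + 6 \<open>logder w\<close> removes the logarithmic
  derivative of w.\<close>

lemma eis4_minus_dil: "eis4 - 25 * dil eis4 = eta_quot ^ 2 * (3000 * hauptmodul ^ 2 - 24)"
proof -
  define P where "P = eis2"
  define z where "z = eis2_5"
  define w where "w = eta_quot"
  define h where "h = hauptmodul"
  define l where "l = logder w"
  have P1: "5 * dil P = P + 4 * z"
    unfolding P_def z_def eis2_5_def by (simp add: field_simps)
  have l: "P = z + 6 * l"
  proof -
    have "l = - 5 * lambert 1 + 5 * dil (lambert 1)"
      unfolding l_def w_def eta_quot_def
      by (subst logder_divide) (simp_all add: logder_power logder_euler logder_dil)
    thus ?thesis by (simp add: P_def z_def eis2_def eis2_5_lambert)
  qed
  have "25 * dil eis4 = (5 * dil P) ^ 2 - 12 * (5 * (5 * dil (qderiv P)))"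
    unfolding eis4_eis2 P_def dil_simps dil_numeral by Groebner_Basis.algebra
  also have "5 * (5 * dil (qderiv P)) = qderiv (5 * dil P)"
    by (simp add: qderiv_dil)
  also have "5 * dil P = P + 4 * z" by (rule P1)
  also have "qderiv (P + 4 * z) = qderiv P + 4 * qderiv z" by simp
  finally have 1: "25 * dil eis4 = (P + 4 * z) ^ 2 - 12 * (qderiv P + 4 * qderiv z)" .
  have zsq: "z * z = w * w * (1 + 22 * h + 125 * (h * h))"
    using eis2_5_square by (simp add: z_def w_def h_def power2_eq_square)
  have dw: "qderiv w = w * l" by (simp add: l_def w_def qderiv_conv_logder)
  have dh: "qderiv h = h * z" by (simp add: h_def z_def qderiv_conv_logder logder_hauptmodul)
  have "2 * z * qderiv z = 2 * l * (w * w * (1 + 22 * h + 125 * (h * h))) + w * w * (22 * h + 250 * (h * h)) * z"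
  proof -
    have "2 * z * qderiv z = qderiv (w * w * (1 + 22 * h + 125 * (h * h)))"
      unfolding zsq[symmetric] qderiv_mult by Groebner_Basis.algebra
    also have "\<dots> = (w * l * w + w * (w * l)) * (1 + 22 * h + 125 * (h * h)) +
       w * w * (22 * (h * z) + 125 * (h * z * h + h * (h * z)))"
      by (simp add: qderiv_mult dw dh)
    finally show ?thesis by Groebner_Basis.algebra
  qed
  hence "z * (2 * (qderiv z - z * l - w * w * (11 * h + 125 * (h * h)))) = 0"
    unfolding zsq[symmetric] by Groebner_Basis.algebra
  moreover have "z \<noteq> 0" by (simp add: z_def)
  ultimately have "qderiv z - z * l - w * w * (11 * h + 125 * (h * h)) = 0"
    by (metis mult_eq_0_iff zero_neq_numeral)
  hence dz: "qderiv z = z * l + w * w * (11 * h + 125 * (h * h))"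
    by Groebner_Basis.algebra
  have "eis4 = P ^ 2 - 12 * qderiv P" unfolding P_def by (rule eis4_eis2)
  hence "eis4 - 25 * dil eis4 = 48 * qderiv z - 4 * z * (2 * P + 4 * z)"
    unfolding 1 by Groebner_Basis.algebra
  also have "\<dots> = w ^ 2 * (3000 * h ^ 2 - 24)"
    unfolding dz l using zsq by Groebner_Basis.algebra
  finally show ?thesis by (simp add: w_def h_def)
qed

text \<open>V maps the right side to w^2 (1 + 10h + 5h^2). Subtracting 25 times this from the right
  side gives w^2 (3000 h^2 - 24), exactly as for \<open>eis4\<close>, so the difference
  \<open>eps\<close> is 25 times its V-image and vanishes.\<close>

lemma eis4_hauptmodul: "eis4 = eta_quot ^ 2 * (1 + 250 * hauptmodul + 3125 * hauptmodul ^ 2)"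
proof -
  define Y where "Y = eta_ratio"
  define k where "k = kpoly Y"
  define h where "h = hauptmodul"
  define h1 where "h1 = dil hauptmodul"
  define w where "w = eta_quot"
  define w1 where "w1 = dil eta_quot"
  have w1: "w * k = Y ^ 4 * w1" unfolding w_def w1_def k_def Y_def by (rule eta_quot_kpoly)
  have h: "h * Y ^ 5 = k" unfolding h_def k_def Y_def hauptmodul_kpoly by simp
  have h1: "h1 * (Y * k) = 1" unfolding h1_def k_def Y_def by (rule dil_hauptmodul)
  have "Y ^ 10 * k ^ 2 * (w1 ^ 2 * (1 + 250 * h1 + 3125 * h1 ^ 2)) = 
    (Y ^ 4 * w1) ^ 2 * ((Y * k) ^ 2 + 250 * (Y * k) * (h1 * (Y * k)) + 3125 * (h1 * (Y * k)) ^ 2)"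
    by Groebner_Basis.algebra
  also have "\<dots> = (w * k) ^ 2 * ((Y * k) ^ 2 + 250 * (Y * k) + 3125)"
    unfolding h1 w1[symmetric] by simp
  also have "(Y * k) ^ 2 + 250 * (Y * k) + 3125 = Y ^ 10 + 10 * k * Y ^ 5 + 5 * k ^ 2"
    unfolding k_def kpoly_def by Groebner_Basis.algebra
  also have "\<dots> = Y ^ 10 + 10 * (h * Y ^ 5) * Y ^ 5 + 5 * (h * Y ^ 5) ^ 2"
    unfolding h ..
  also have "(w * k) ^ 2 * \<dots> = Y ^ 10 * k ^ 2 * (w ^ 2 * (1 + 10 * h + 5 * h ^ 2))"
    by Groebner_Basis.algebra
  finally have eq: "w1 ^ 2 * (1 + 250 * h1 + 3125 * h1 ^ 2) = w ^ 2 * (1 + 10 * h + 5 * h ^ 2)"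
    unfolding Y_def k_def by (rule eta_ratio_kpoly_cancel)
  define eps where "eps = eis4 - w ^ 2 * (1 + 250 * h + 3125 * h ^ 2)"
  have "dil eps = dil eis4 - w1 ^ 2 * (1 + 250 * h1 + 3125 * h1 ^ 2)"
    by (simp add: eps_def w_def h_def w1_def h1_def)
  hence "eps = 25 * dil eps"
    using eis4_minus_dil unfolding eq eps_def w_def[symmetric] h_def[symmetric] by Groebner_Basis.algebra
  hence eps: "eps = fls_const 25 * dil eps" by simp
  hence "eps $$ 0 = (fls_const 25 * dil eps) $$ 0" by (rule arg_cong)
  also have "\<dots> = 25 * eps $$ 0" by (simp only: fls_mult_const_nth dil_nth) simp
  finally have "eps $$ 0 = 0" by simp
  with dil_fixed_imp_const[OF eps] have "eps = 0" by simp
  thus ?thesis by (simp add: eps_def w_def h_def)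
qed

section \<open>The action of the section operator\<close>

definition mu :: "int \<Rightarrow> complex fls" where
  "mu m = sect (eta_ratio powi m)"

lemma mu_values: "mu 0 = 1" "mu 1 = -1" "mu 2 = -1" "mu 3 = 5" "mu 4 = -5"
  using sect_eta_ratio_powers by (simp_all add: mu_def sect_rr_powers)

text \<open>Insert 1 = \<open>dil hauptmodul * (Y * kpoly Y)\<close> before applying U; the V-image
  leaves U as \<open>hauptmodul\<close>.\<close>

lemma mu_rec:
  "mu m = hauptmodul * (mu (m + 5) + 5 * mu (m + 4) + 15 * mu (m + 3) + 25 * mu (m + 2) + 25 * mu (m + 1))"
proof -
  let ?y = "eta_ratio powi m"
  have p: "eta_ratio powi (m + numeral j) = eta_ratio ^ numeral j * ?y" "eta_ratio powi (m + 1) = eta_ratio * ?y" for j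
    by (simp_all add: power_int_add)
  have "?y = dil hauptmodul * (eta_ratio * kpoly eta_ratio * ?y)"
    using dil_hauptmodul by Groebner_Basis.algebra
  also have "eta_ratio * kpoly eta_ratio * ?y = eta_ratio powi (m + 5) + 5 * eta_ratio powi (m + 4) + 
      15 * eta_ratio powi (m + 3) + 25 * eta_ratio powi (m + 2) + 25 * eta_ratio powi (m + 1)"
    unfolding p kpoly_def by Groebner_Basis.algebra
  finally have "sect ?y = sect (dil hauptmodul * \<dots>)" by (rule arg_cong)
  thus ?thesis unfolding mu_def by (simp only: sect_dil_mult sect_add sect_const_mult)
qed

text \<open>By w = Y^5 (V h) (V w) and h = 1 / (Y^6 V h) the argument is Y^(10-6i+s) times the
  V-image of w^2 h^(2-i), which passes through U.\<close>

lemma sect_basis: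
  "sect (eta_quot ^ 2 * hauptmodul powi i * eta_ratio powi s) = 
     eta_quot ^ 2 * hauptmodul powi (2 - i) * mu (10 - 6 * i + s)"
proof -
  define Y where "Y = eta_ratio"
  define h where "h = hauptmodul"
  define h1 where "h1 = dil hauptmodul"
  define w1 where "w1 = dil eta_quot"
  have nz: "Y \<noteq> 0" "h \<noteq> 0" "h1 \<noteq> 0" by (simp_all add: Y_def h_def h1_def)
  have w: "eta_quot = Y ^ 5 * h1 * w1"
    using eta_quot_kpoly dil_hauptmodul kpoly_nonzero
    unfolding Y_def h1_def w1_def dil_hauptmodul_kpoly by (simp add: field_simps) Groebner_Basis.algebra
  have "h * h1 * Y ^ 6 = 1" unfolding h_def h1_def Y_def by (rule hauptmodul_mult_dil)
  hence h: "h = Y powi (-6) * h1 powi (-1)"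
    using nz by (simp add: power_int_minus field_simps)
  have hi: "h powi i = Y powi (- 6 * i) * h1 powi (- i)"
    unfolding h power_int_mult_distrib power_int_mult[symmetric] by simp
  have "eta_quot ^ 2 * h powi i * Y powi s = 
    (Y ^ 10 * Y powi (- 6 * i) * Y powi s) * (h1 ^ 2 * h1 powi (- i) * w1 ^ 2)"
    unfolding w hi by Groebner_Basis.algebra
  also have "Y ^ 10 * Y powi (- 6 * i) * Y powi s = Y powi (10 - 6 * i + s)"
    using nz by (simp add: power_int_add power_int_diff power_int_minus field_simps)
  also have "h1 ^ 2 * h1 powi (- i) = h1 powi (2 - i)"
    using nz by (simp add: power_int_diff power_int_minus field_simps)
  also have "h1 powi (2 - i) * w1 ^ 2 = dil (h powi (2 - i) * eta_quot ^ 2)"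
    by (simp add: h1_def w1_def h_def)
  finally have "sect (eta_quot ^ 2 * h powi i * Y powi s) = sect (Y powi (10 - 6 * i + s)) * (h powi (2 - i) * eta_quot ^ 2)"
    by (simp only: sect_mult_dil)
  thus ?thesis
    by (simp only: Y_def h_def mu_def mult_ac)
qed

text \<open>Only sums are taken, but the generating sets below contain all integer multiples, so
  these spans are closed under integer combinations. This avoids handling polynomial
  coefficients.\<close>

inductive_set addspan :: "complex fls set \<Rightarrow> complex fls set" for B where
  zero: "0 \<in> addspan B"
| step: "b \<in> B \<Longrightarrow> x \<in> addspan B \<Longrightarrow> b + x \<in> addspan B"

lemma addspan_base: "b \<in> B \<Longrightarrow> b \<in> addspan B"
  using addspan.step[OF _ addspan.zero, of b] by simp

lemma addspan_add: "x \<in> addspan B \<Longrightarrow> y \<in> addspan B \<Longrightarrow> x + y \<in> addspan B"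
  by (induction rule: addspan.induct) (auto intro: addspan.step simp: add.assoc)

lemma addspan_image:
  assumes "x \<in> addspan B" "\<And>u v. f (u + v) = f u + f v" "f 0 = 0" "\<And>b. b \<in> B \<Longrightarrow> f b \<in> addspan C"
  shows "f x \<in> addspan C"
  using assms(1) by induction (auto simp: assms(2,3) intro: addspan_add assms(4) addspan.zero)

text \<open>The condition says that the coefficient of \<open>h\<^sup>j\<close> has 5-adic valuation at least
  \<open>(5j - d - 2)/2\<close>, which is Watson's bound \<open>\<lfloor>(5j - d - 1)/2\<rfloor>\<close>.\<close>

definition mu_basis :: "int \<Rightarrow> complex fls set" where
  "mu_basis d = {of_int (c * 5 ^ e) * hauptmodul powi j | c e j. 5 * j \<le> 2 * int e + d + 2 \<and> d \<le> 5 * j}"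

lemma mu_basisI:
  "5 * j \<le> 2 * int e + d + 2 \<Longrightarrow> d \<le> 5 * j \<Longrightarrow> of_int (c * 5 ^ e) * hauptmodul powi j \<in> mu_basis d"
  unfolding mu_basis_def by blast

text \<open>One term of \<open>mu_rec\<close>. Multiplying by h raises \<open>5 * j\<close> by 5,
  which the index shift \<open>s\<close> and the \<open>v\<close> factors 5 have to pay for;
  \<open>s \<le> 5\<close> preserves the lower bound on \<open>j\<close>.\<close>

lemma mu_basis_shift:
  assumes "x \<in> addspan (mu_basis (d - s))" "5 \<le> 2 * int v + s" "s \<le> 5"
  shows "hauptmodul * (of_int (c * 5 ^ v) * x) \<in> addspan (mu_basis d)"
  using assms(1)
proof (rule addspan_image[where f = "\<lambda>x. hauptmodul * (of_int (c * 5 ^ v) * x)"])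
  fix b assume "b \<in> mu_basis (d - s)"
  then obtain c' e j where b: "b = of_int (c' * 5 ^ e) * hauptmodul powi j"
    "5 * j \<le> 2 * int e + (d - s) + 2" "d - s \<le> 5 * j"
    unfolding mu_basis_def by blast
  have "hauptmodul * (of_int (c * 5 ^ v) * b) = of_int (c * c' * 5 ^ (v + e)) * hauptmodul powi (j + 1)"
    unfolding b by (simp add: power_int_add power_add)
  also have "\<dots> \<in> mu_basis d"
    using b assms by (intro mu_basisI) auto
  finally show "hauptmodul * (of_int (c * 5 ^ v) * b) \<in> addspan (mu_basis d)"
    by (rule addspan_base)
qed (simp_all add: algebra_simps)

text \<open>The coefficients 1, 5, 15, 25, 25 of \<open>mu_rec\<close> give (s, v) = (5,0), (4,1),
  (3,1), (2,2), (1,2), all with 5 <= 2v + s. The base cases \<open>d = -3\<close> and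
  \<open>d = -4\<close> rely on 5 dividing \<open>mu 3\<close> and \<open>mu 4\<close>.\<close>

lemma mu_mem: "d \<ge> -4 \<Longrightarrow> mu (- d) \<in> addspan (mu_basis d)"
proof (induction "nat (d + 4)" arbitrary: d rule: less_induct)
  case less
  consider "d = 0" | "d = -1" | "d = -2" | "d = -3" | "d = -4" | "d \<ge> 1" using less.prems by linarith
  thus ?case
  proof cases
    case 6
    have IH: "mu (- (d - s)) \<in> addspan (mu_basis (d - s))" if "1 \<le> s" "s \<le> 5" for s
      using that 6 by (intro less.hyps) auto
    have "mu (- d) = hauptmodul * (of_int (1 * 5 ^ 0) * mu (- (d - 5))) + hauptmodul * (of_int (1 * 5 ^ 1) * mu (- (d - 4))) +
       hauptmodul * (of_int (3 * 5 ^ 1) * mu (- (d - 3))) + hauptmodul * (of_int (1 * 5 ^ 2) * mu (- (d - 2))) +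
       hauptmodul * (of_int (1 * 5 ^ 2) * mu (- (d - 1)))"
      by (subst mu_rec) (simp add: algebra_simps)
    also have "\<dots> \<in> addspan (mu_basis d)"
      by (intro addspan_add mu_basis_shift[OF IH[of 5]] mu_basis_shift[OF IH[of 4]]
            mu_basis_shift[OF IH[of 3]] mu_basis_shift[OF IH[of 2]] mu_basis_shift[OF IH[of 1]]) simp_all
    finally show ?thesis .
  qed (use mu_basisI[of 0 0 0 1] mu_basisI[of 0 0 "-1" "-1"] mu_basisI[of 0 0 "-2" "-1"] 
         mu_basisI[of 0 1 "-3" 1] mu_basisI[of 0 1 "-4" "-1"] in
       \<open>auto simp: mu_values intro!: addspan_base\<close>)
qed

text \<open>Multiples of h^j by 5^(k+j-1), with no constant term: the shape that U improves from
  \<open>k\<close> to \<open>Suc k\<close>.\<close>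

definition lvl_basis :: "nat \<Rightarrow> complex fls set" where
  "lvl_basis k = {of_int (c * 5 ^ a) * hauptmodul powi j | c a j. 1 \<le> j \<and> int k + j - 1 \<le> int a}"

lemma lvl_basisI:
  "1 \<le> j \<Longrightarrow> int k + j - 1 \<le> int a \<Longrightarrow> of_int (c * 5 ^ a) * hauptmodul powi j \<in> lvl_basis k"
  unfolding lvl_basis_def by blast

lemma sect_lvl_basis:
  assumes "x \<in> addspan (lvl_basis k)" "s \<in> {0, -1}"
  shows "\<exists>y\<in>addspan (lvl_basis (Suc k)). sect (eta_quot ^ 2 * x * eta_ratio powi s) = eta_quot ^ 2 * y"
proof -
  define f where "f = (\<lambda>x. sect (eta_quot ^ 2 * x * eta_ratio powi s) / eta_quot ^ 2)"
  have "f x \<in> addspan (lvl_basis (Suc k))"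
    using assms(1)
  proof (rule addspan_image[where f = f])
    fix b assume "b \<in> lvl_basis k"
    then obtain c a i where b: "b = of_int (c * 5 ^ a) * hauptmodul powi i" "1 \<le> i" "int k + i - 1 \<le> int a"
      unfolding lvl_basis_def by blast
    have "eta_quot ^ 2 * b * eta_ratio powi s = 
        of_int (c * 5 ^ a) * (eta_quot ^ 2 * hauptmodul powi i * eta_ratio powi s)"
      unfolding b by (simp only: mult_ac)
    hence fb: "f b = of_int (c * 5 ^ a) * (hauptmodul powi (2 - i) * mu (- (6 * i - 10 - s)))"
      unfolding f_def by (simp only: sect_const_mult sect_basis) (simp add: algebra_simps)
    \<comment> \<open>The index is at least -4 because \<open>i \<ge> 1\<close>, with equality for
      \<open>i = 1\<close>, \<open>s = 0\<close>: the extreme base case of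
      \<open>mu_mem\<close>.\<close>
    have "mu (- (6 * i - 10 - s)) \<in> addspan (mu_basis (6 * i - 10 - s))"
      using b assms(2) by (intro mu_mem) auto
    thus "f b \<in> addspan (lvl_basis (Suc k))" unfolding fb
    proof (rule addspan_image[where f = "\<lambda>x. of_int (c * 5 ^ a) * (hauptmodul powi (2 - i) * x)"])
      fix u assume "u \<in> mu_basis (6 * i - 10 - s)"
      then obtain c' e j where u: "u = of_int (c' * 5 ^ e) * hauptmodul powi j"
        "5 * j \<le> 2 * int e + (6 * i - 10 - s) + 2" "6 * i - 10 - s \<le> 5 * j"
        unfolding mu_basis_def by blast
      have "of_int (c * 5 ^ a) * (hauptmodul powi (2 - i) * u) = 
          of_int (c * c' * 5 ^ (a + e)) * hauptmodul powi (2 - i + j)"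
        unfolding u by (simp add: power_int_add power_add)
      also have "\<dots> \<in> lvl_basis (Suc k)"
      proof (rule lvl_basisI)
        \<comment> \<open>Five times the right side is at least \<open>i - s\<close>, which is
          positive.\<close>
        show "1 \<le> 2 - i + j" using u(3) b(2) assms(2) by auto
        \<comment> \<open>Integrality matters: for \<open>i = 1\<close>, \<open>s = -1\<close>,
          \<open>j = 0\<close> the bound only says 1 <= 2e, while \<open>e \<ge> 1\<close> is
          required.\<close>
        show "int (Suc k) + (2 - i + j) - 1 \<le> int (a + e)"
          using u(2,3) b(2,3) assms(2) by (auto; presburger)
      qed
      finally show "of_int (c * 5 ^ a) * (hauptmodul powi (2 - i) * u) \<in> addspan (lvl_basis (Suc k))"
        by (rule addspan_base)
    qed (simp_all add: algebra_simps)
  qed (simp_all add: f_def algebra_simps add_divide_distrib)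
  moreover have "sect (eta_quot ^ 2 * x * eta_ratio powi s) = eta_quot ^ 2 * f x"
    by (simp add: f_def)
  ultimately show ?thesis by blast
qed

text \<open>Index 9 is above the initial values, so the recurrence is solved for its top term and
  run upwards.\<close>

lemma mu_9: "hauptmodul ^ 2 * mu 9 = - 90 * hauptmodul - 625 * hauptmodul ^ 2"
proof -
  have 5: "hauptmodul * mu 5 = 1"
    using mu_rec[of 0] by (simp add: mu_values)
  have 6: "hauptmodul * mu 6 = - 6 - 25 * hauptmodul"
    using mu_rec[of 1] 5 by (simp add: mu_values) Groebner_Basis.algebra
  have 7: "hauptmodul * mu 7 = 14 + 125 * hauptmodul"
    using mu_rec[of 2] 5 6 by (simp add: mu_values) Groebner_Basis.algebra
  have 8: "hauptmodul * mu 8 = - 125 * hauptmodul"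
  proof -
    have "hauptmodul * mu 8 = mu 3 - 5 * (hauptmodul * mu 7) - 15 * (hauptmodul * mu 6) - 
            25 * (hauptmodul * mu 5) - 25 * (hauptmodul * mu 4)"
      by (subst mu_rec[of 3]) (simp add: algebra_simps)
    also have "\<dots> = - 125 * hauptmodul" unfolding 5 6 7 mu_values by (simp add: algebra_simps)
    finally show ?thesis .
  qed
  have "hauptmodul * mu 9 = - 90 - 625 * hauptmodul"
  proof -
    have "hauptmodul * mu 9 = mu 4 - 5 * (hauptmodul * mu 8) - 15 * (hauptmodul * mu 7) - 
            25 * (hauptmodul * mu 6) - 25 * (hauptmodul * mu 5)"
      by (subst mu_rec[of 4]) (simp add: algebra_simps)
    also have "\<dots> = - 90 - 625 * hauptmodul" unfolding 5 6 7 8 mu_values by (simp add: algebra_simps)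
    finally show ?thesis .
  qed
  thus ?thesis by Groebner_Basis.algebra
qed

lemma sect_eis4_lvl_basis: "\<exists>y\<in>addspan (lvl_basis 1). sect (eis4 * eta_ratio powi (-1)) = eta_quot ^ 2 * y"
proof
  let ?h = hauptmodul
  \<comment> \<open>The coefficient at h is -90 + 250 * 5 = 232 * 5 and the one at h^2 is -5^4, from
    \<open>mu_9\<close> and \<open>mu 3 = 5\<close>.\<close>
  define y where "y = of_int (232 * 5 ^ 1) * ?h powi 1 + of_int ((-1) * 5 ^ 4) * ?h powi 2 + 3125 * mu (- 3)"
  have "eis4 * eta_ratio powi (-1) = eta_quot ^ 2 * ?h powi 0 * eta_ratio powi (-1) +
    250 * (eta_quot ^ 2 * ?h powi 1 * eta_ratio powi (-1)) + 3125 * (eta_quot ^ 2 * ?h powi 2 * eta_ratio powi (-1))"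
    unfolding eis4_hauptmodul by (simp add: algebra_simps)
  hence "sect (eis4 * eta_ratio powi (-1)) = eta_quot ^ 2 * (?h ^ 2 * mu 9 + 250 * (?h * mu 3) + 3125 * mu (-3))"
    by (simp only: sect_add sect_const_mult sect_basis) (simp add: algebra_simps)
  also have "\<dots> = eta_quot ^ 2 * y"
    unfolding mu_9 mu_values y_def by (simp add: algebra_simps)
  finally show "sect (eis4 * eta_ratio powi (-1)) = eta_quot ^ 2 * y" .
  have "mu (- 3) \<in> addspan (mu_basis 3)" by (rule mu_mem) simp
  hence "3125 * mu (- 3) \<in> addspan (lvl_basis 1)"
  proof (rule addspan_image[where f = "\<lambda>x. 3125 * x"])
    fix u assume "u \<in> mu_basis 3"
    then obtain c e j where u: "u = of_int (c * 5 ^ e) * hauptmodul powi j"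
      "5 * j \<le> 2 * int e + 3 + 2" "3 \<le> 5 * j"
      unfolding mu_basis_def by blast
    have "3125 * u = of_int (c * 5 ^ (e + 5)) * hauptmodul powi j"
      unfolding u by (simp add: power_add)
    also have "\<dots> \<in> lvl_basis 1" using u by (intro lvl_basisI) auto
    finally show "3125 * u \<in> addspan (lvl_basis 1)" by (rule addspan_base)
  qed (simp_all add: algebra_simps)
  moreover have "of_int (232 * 5 ^ 1) * ?h powi 1 \<in> lvl_basis 1" "of_int ((-1) * 5 ^ 4) * ?h powi 2 \<in> lvl_basis 1"
    by (rule lvl_basisI; simp)+
  ultimately show "y \<in> addspan (lvl_basis 1)"
    unfolding y_def by (blast intro: addspan_add addspan_base)
qed

section \<open>Divisibility of the coefficients\<close>

text \<open>The coefficients live in a field, so divisibility is expressed through integers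
  representing them.\<close>

definition coeffs_mult :: "int \<Rightarrow> complex fls \<Rightarrow> bool" where
  "coeffs_mult N F \<longleftrightarrow> (\<forall>n. \<exists>c. F $$ n = of_int (N * c))"

lemma coeffs_mult_mult:
  assumes "coeffs_mult M F" "coeffs_mult N G"
  shows "coeffs_mult (M * N) (F * G)"
proof -
  from assms obtain c d where cd: "\<And>n. F $$ n = of_int (M * c n)" "\<And>n. G $$ n = of_int (N * d n)"
    unfolding coeffs_mult_def by metis
  have "(F * G) $$ n = of_int (M * N * (\<Sum>i=fls_subdegree F..n - fls_subdegree G. c i * d (n - i)))" for n
    unfolding fls_times_nth(2) cd by (simp add: sum_distrib_left mult_ac)
  thus ?thesis unfolding coeffs_mult_def by blast
qed

lemma coeffs_mult_add:
  assumes "coeffs_mult N F" "coeffs_mult N G"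
  shows "coeffs_mult N (F + G)"
  unfolding coeffs_mult_def
proof
  fix n
  obtain c d where "F $$ n = of_int (N * c)" "G $$ n = of_int (N * d)"
    using assms unfolding coeffs_mult_def by metis
  hence "(F + G) $$ n = of_int (N * (c + d))" by (simp add: algebra_simps)
  thus "\<exists>c. (F + G) $$ n = of_int (N * c)" by blast
qed

lemma coeffs_mult_of_int: "coeffs_mult N (of_int (c * N))"
  unfolding coeffs_mult_def fls_of_int fls_const_nth
  by (metis mult.commute mult_zero_right of_int_0)

lemma coeffs_mult_power: "coeffs_mult 1 F \<Longrightarrow> coeffs_mult 1 (F ^ n)"
proof (induction n)
  case 0
  show ?case using coeffs_mult_of_int[of 1 1] by simp
next
  case (Suc n)
  thus ?case using coeffs_mult_mult[of 1 F 1 "F ^ n"] by simp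
qed

lemma coeffs_mult_X: "coeffs_mult 1 fls_X"
  unfolding coeffs_mult_def by (auto intro: exI[of _ 0] exI[of _ 1])

lemma coeffs_mult_dil: "coeffs_mult N F \<Longrightarrow> coeffs_mult N (dil F)"
  unfolding coeffs_mult_def dil_nth by (metis mult_zero_right of_int_0)

lemma coeffs_mult_addspan:
  assumes "x \<in> addspan (lvl_basis k)" "coeffs_mult 1 hauptmodul"
  shows "coeffs_mult (5 ^ k) x"
  using assms(1)
proof induction
  case zero
  show ?case using coeffs_mult_of_int[of "5 ^ k" 0] by simp
next
  case (step b x)
  then obtain c a j where b: "b = of_int (c * 5 ^ a) * hauptmodul powi j" "1 \<le> j" "int k + j - 1 \<le> int a"
    unfolding lvl_basis_def by blast
  have "5 ^ a = (5 ^ (a - k) * 5 ^ k :: int)" using b by (simp flip: power_add)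
  hence "b = of_int (c * 5 ^ (a - k) * 5 ^ k) * hauptmodul ^ nat j"
    unfolding b using b(2) by (simp add: power_int_def)
  moreover have "coeffs_mult (5 ^ k * 1) (of_int (c * 5 ^ (a - k) * 5 ^ k) * hauptmodul ^ nat j)"
    by (intro coeffs_mult_mult coeffs_mult_of_int coeffs_mult_power assms(2))
  ultimately have "coeffs_mult (5 ^ k) b" by simp
  thus ?case using step.IH by (rule coeffs_mult_add)
qed

section \<open>Agreement of the formal series with the analytic definitions\<close>

lemma euler_fps_expansion:
  obtains F where "euler_prod has_fps_expansion F" "fps_to_fls F = euler"
    "\<And>n. fps_nth F n \<in> \<int>" "fps_nth F 0 = 1"
proof -
  obtain F where F: "euler_prod has_fps_expansion F" "\<And>n. fps_nth F n \<in> \<int>" "fps_nth F 0 = 1"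
    using euler_prod_expansion by blast
  let ?P = "\<lambda>N (q::complex). \<Prod>n<N. 1 - q ^ Suc n"
  let ?G = "\<lambda>N. \<Prod>n<N. (1 - fps_X ^ Suc n :: complex fps)"
  have G: "?P N has_fps_expansion ?G N" for N
    by (intro fps_expansion_intros)
  have GE: "eprod N = fps_to_fls (?G N)" for N
  proof (induction N)
    case (Suc N)
    have "fls_X ^ Suc N = fps_to_fls (fps_X ^ Suc N :: complex fps)"
      by (simp only: fps_to_fls_power fps_X_to_fls)
    thus ?case unfolding eprod_Suc Suc prod.lessThan_Suc
      by (simp only: fls_times_fps_to_fls fps_to_fls_minus fps_one_to_fls)
  qed simp
  have "fps_nth F n = euler $$ int n" for n
  proof -
    have ul: "uniform_limit (ball 0 (1/2)) ?P euler_prod sequentially"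
      using euler_prod_uniform_limit[of "1/2"] by (rule uniform_limit_on_subset) auto
    have "(\<lambda>N. (deriv ^^ n) (?P N) 0) \<longlonglongrightarrow> (deriv ^^ n) euler_prod 0"
      by (rule higher_deriv_complex_uniform_limit[OF ul])
         (auto intro!: always_eventually holomorphic_intros)
    hence "(\<lambda>N. (deriv ^^ n) (?P N) 0 / fact n) \<longlonglongrightarrow> (deriv ^^ n) euler_prod 0 / fact n"
      by (intro tendsto_intros) auto
    hence "(\<lambda>N. fps_nth (?G N) n) \<longlonglongrightarrow> fps_nth F n"
      by (simp only: fps_nth_fps_expansion[OF F(1)] fps_nth_fps_expansion[OF G])
    \<comment> \<open>The coefficient sequence converges analytically and is eventually constant, so
      the two limits agree.\<close>
    moreover have "eventually (\<lambda>N. fps_nth (?G N) n = euler $$ int n) sequentially"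
      using eventually_ge_at_top[of n]
    proof eventually_elim
      case (elim N)
      have "(euler - eprod N) $$ int n = 0"
        using vanish_euler_diff[of N] elim unfolding vanish_def by auto
      thus ?case by (simp add: GE)
    qed
    ultimately show ?thesis by (metis LIMSEQ_unique tendsto_eventually)
  qed
  hence "fps_to_fls F = euler"
    using unit1_imp_vanish[OF unit1_euler] by (auto simp: fls_eq_iff vanish_def) 
  with F show ?thesis using that by blast
qed

text \<open>The quotient has integer Taylor coefficients whose power series has the defining
  property of \<open>e4\<close>, so \<open>e4_unique\<close> identifies them.\<close>

lemma e4_coeff: "(eis4 / euler) $$ int n = of_int (e4 n)"
  and coeffs_mult_euler: "coeffs_mult 1 euler" "coeffs_mult 1 (inverse euler)"
proof -
  obtain F where F: "euler_prod has_fps_expansion F" "fps_to_fls F = euler"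
    "\<And>n. fps_nth F n \<in> \<int>" "fps_nth F 0 = 1"
    using euler_fps_expansion by blast
  have "subdegree F = 0" using F(4) by (intro subdegreeI) auto
  hence inv: "inverse euler = fps_to_fls (inverse F)"
    unfolding F(2)[symmetric] by (rule fls_inverse_fps_to_fls)
  have Ints: "coeffs_mult 1 (fps_to_fls G)" if "\<And>n. fps_nth G n \<in> \<int>" for G :: "complex fps"
    unfolding coeffs_mult_def
  proof
    fix m
    have "fps_to_fls G $$ m \<in> \<int>" using that by (cases "m < 0") auto
    thus "\<exists>c. fps_to_fls G $$ m = of_int (1 * c)" by (auto elim: Ints_cases)
  qed
  show "coeffs_mult 1 euler" unfolding F(2)[symmetric] by (intro Ints F)
  show "coeffs_mult 1 (inverse euler)" unfolding inv by (intro Ints Ints_fps_inverse F)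
  have "eis4 = fps_to_fls E4_fps"
  proof (rule fls_eqI)
    fix m :: int
    have "(240 * lambert 3) $$ m = 240 * lambert 3 $$ m"
      by (metis fls_const_numeral fls_mult_const_nth(1))
    thus "eis4 $$ m = fps_to_fls E4_fps $$ m"
      unfolding eis4_def by (auto simp: lambert_nth E4_fps_def sigma3_def)
  qed
  hence quot: "eis4 / euler = fps_to_fls (E4_fps * inverse F)"
    by (simp add: divide_inverse inv fls_times_fps_to_fls)
  let ?f = "\<lambda>q. eval_fps E4_fps q * inverse (euler_prod q)"
  let ?H = "E4_fps * inverse F"
  have 1: "?f has_fps_expansion ?H"
    using F(4) less_le_trans[OF _ E4_fps_conv_radius, of 0]
    by (intro has_fps_expansion_mult has_fps_expansion_inverse F eval_fps_has_fps_expansion) auto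
  have "fps_nth E4_fps n \<in> \<int>" for n
    by (auto simp: E4_fps_def)
  hence "fps_nth ?H n \<in> \<int>" for n
    using Ints_fps_inverse[OF F(3,4)] by (rule Ints_fps_mult)
  hence "\<exists>z. fps_nth ?H n = of_int z" for n
    by (meson Ints_cases)
  then obtain a where a: "fps_nth ?H n = of_int (a n)" for n
    by metis
  have "ereal (norm q) < fps_conv_radius E4_fps" if "norm q < 1" for q :: complex
    using that by (intro less_le_trans[OF _ E4_fps_conv_radius]) simp
  hence holo: "?f holomorphic_on ball 0 1"
    using euler_prod_props(2) by (intro holomorphic_intros euler_prod_holomorphic) auto
  have "(\<lambda>n. of_int (a n) * nome \<tau> ^ n) sums (E4 \<tau> / euler_prod (nome \<tau>))" if "Im \<tau> > 0" for \<tau>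
  proof -
    have "(\<lambda>n. (deriv ^^ n) ?f 0 / fact n * (nome \<tau> - 0) ^ n) sums ?f (nome \<tau>)"
      by (rule holomorphic_power_series[OF holo]) (use norm_nome_less_1[OF that] in auto)
    thus ?thesis
      unfolding fps_nth_fps_expansion[OF 1, symmetric] a
      by (simp add: E4_conv_eval_fps[OF that] field_simps)
  qed
  hence "e4 = a" by (intro e4_unique sums_e4)
  thus "(eis4 / euler) $$ int n = of_int (e4 n)" unfolding quot by (simp add: a)
qed

fun e4_series :: "nat \<Rightarrow> complex fls" where
  "e4_series 0 = eis4 / euler"
| "e4_series (Suc k) = sect (if even k then fls_X * e4_series k else e4_series k)"

text \<open>Every multiplication by q before U lowers the argument, by 5^i at the even step i. By
  \<open>e4_shift_eq\<close>, \<open>- e4_shift k\<close> is an inverse of 24 modulo 5^k.\<close>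

fun e4_shift :: "nat \<Rightarrow> int" where
  "e4_shift 0 = 0"
| "e4_shift (Suc k) = e4_shift k + (if even k then 5 ^ k else 0)"

lemma e4_series_nth: "e4_series k $$ n = (eis4 / euler) $$ (5 ^ k * n - e4_shift k)"
  by (induction k arbitrary: n) (auto simp: fls_X_times_conv_shift algebra_simps)

lemma e4_shift_eq: "24 * e4_shift k + 1 = (if even k then 5 ^ k else 5 ^ (k + 1))"
  by (induction k) auto

text \<open>Moving the Euler factor inside U applies V to it. In steps with a factor q this produces
  q V V E / E = 1/Y, in the others Y^0: the cases s = -1 and s = 0 of
  \<open>sect_lvl_basis\<close>.\<close>

lemma e4_series_lvl:
  "\<exists>y\<in>addspan (lvl_basis (Suc k)). 
     (if even k then dil euler else euler) * e4_series (Suc k) = eta_quot ^ 2 * y"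
proof (induction k)
  case 0
  have "dil euler * e4_series 1 = sect (dil (dil euler) * (fls_X * (eis4 / euler)))"
    unfolding sect_dil_mult by simp
  also have "dil (dil euler) * (fls_X * (eis4 / euler)) = eis4 * eta_ratio powi (-1)"
    by (simp add: eta_ratio_def power_int_minus field_simps)
  finally show ?case using sect_eis4_lvl_basis by simp
next
  case (Suc k)
  then obtain y where y: "y \<in> addspan (lvl_basis (Suc k))"
    "(if even k then dil euler else euler) * e4_series (Suc k) = eta_quot ^ 2 * y" by blast
  show ?case
  proof (cases "even k")
    case True
    hence "euler * e4_series (Suc (Suc k)) = sect (dil euler * e4_series (Suc k))"
      by (simp add: sect_dil_mult)
    also have "\<dots> = sect (eta_quot ^ 2 * y * eta_ratio powi 0)"
      using y(2) True by simp
    finally show ?thesis using sect_lvl_basis[OF y(1), of 0] True by auto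
  next
    case False
    hence "dil euler * e4_series (Suc (Suc k)) = sect (dil (dil euler) * (fls_X * e4_series (Suc k)))"
      by (simp add: sect_dil_mult)
    also have "dil (dil euler) * (fls_X * e4_series (Suc k)) = (euler * e4_series (Suc k)) * eta_ratio powi (-1)"
      by (simp add: eta_ratio_def power_int_minus field_simps)
    also have "euler * e4_series (Suc k) = eta_quot ^ 2 * y"
      using y(2) False by simp
    finally show ?thesis using sect_lvl_basis[OF y(1), of "-1"] False by auto
  qed
qed

lemma e4_series_coeffs:
  assumes "k \<ge> 1"
  shows "coeffs_mult (5 ^ k) (e4_series k)"
proof -
  obtain l where l: "k = Suc l" using assms by (cases k) auto
  obtain y where y: "y \<in> addspan (lvl_basis k)"
    "(if even l then dil euler else euler) * e4_series k = eta_quot ^ 2 * y"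
    using e4_series_lvl[of l] l by blast
  note eul = coeffs_mult_euler coeffs_mult_euler[THEN coeffs_mult_dil]
  have mult: "coeffs_mult 1 (F * G)" if "coeffs_mult 1 F" "coeffs_mult 1 G" for F G
    using coeffs_mult_mult[OF that] by simp
  have "coeffs_mult 1 (fls_X * dil euler ^ 6 * inverse euler ^ 6)"
    by (intro mult coeffs_mult_power coeffs_mult_X eul)
  hence h: "coeffs_mult 1 hauptmodul"
    by (simp add: hauptmodul_def divide_inverse power_inverse)
  have "coeffs_mult 1 (euler ^ 5 * dil (inverse euler))"
    by (intro mult coeffs_mult_power eul)
  hence w: "coeffs_mult 1 eta_quot" by (simp add: eta_quot_def divide_inverse)
  define e where "e = (if even l then dil euler else euler)"
  have e: "e \<noteq> 0" "coeffs_mult 1 (inverse e)"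
    using eul by (auto simp: e_def)
  have "coeffs_mult (1 * (1 * 5 ^ k)) (inverse e * (eta_quot ^ 2 * y))"
    by (intro coeffs_mult_mult e coeffs_mult_power w coeffs_mult_addspan y h)
  also have "inverse e * (eta_quot ^ 2 * y) = e4_series k"
    unfolding y(2)[symmetric] e_def[symmetric] using e by simp
  finally show ?thesis by simp
qed

text \<open>Both \<open>delta 5 k\<close> and \<open>- e4_shift k\<close> invert 24 modulo 5^k, so
  \<open>delta 5 k + e4_shift k\<close> is a multiple of 5^k. It lies strictly between 0 and 2 *
  5^k.\<close>

lemma delta_5:
  assumes "k \<ge> 1"
  shows "int (delta 5 k) = 5 ^ k - e4_shift k"
proof -
  have d: "0 < delta 5 k" "delta 5 k < 5 ^ k" "[24 * delta 5 k = 1] (mod 5 ^ k)"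
    using delta_props[of 5 k] assms by simp_all
  have s: "24 * e4_shift k + 1 = 5 ^ k \<or> 24 * e4_shift k + 1 = 5 * 5 ^ k"
    using e4_shift_eq[of k] by auto
  have pos: "(5 :: int) \<le> 5 ^ k" using power_increasing[of 1 k "5 :: int"] assms by simp
  have "[24 * int (delta 5 k) = 1] (mod 5 ^ k)"
    using d(3) by (simp flip: cong_int_iff)
  hence "5 ^ k dvd (24 * int (delta 5 k) - 1)" by (simp add: cong_iff_dvd_diff)
  moreover have "5 ^ k dvd (24 * e4_shift k + 1)" using s by auto
  ultimately have "5 ^ k dvd ((24 * int (delta 5 k) - 1) + (24 * e4_shift k + 1))"
    by (rule dvd_add)
  hence "5 ^ k dvd (24 * (int (delta 5 k) + e4_shift k))" by (simp add: algebra_simps)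
  moreover have "coprime (5 ^ k) (24 :: int)"
  proof -
    have "coprime (5 :: int) 24"
    proof (rule coprimeI)
      fix d :: int assume "d dvd 5" "d dvd 24"
      hence "d dvd 5 * 5 - 24" by (intro dvd_diff dvd_mult)
      thus "is_unit d" by simp
    qed
    thus ?thesis by simp
  qed
  ultimately have "5 ^ k dvd (int (delta 5 k) + e4_shift k)"
    using coprime_dvd_mult_right_iff by blast
  then obtain t where t: "int (delta 5 k) + e4_shift k = 5 ^ k * t" by blast
  have b: "0 < int (delta 5 k)" "int (delta 5 k) < 5 ^ k" using d(1,2) by (simp, metis of_nat_less_iff of_nat_numeral of_nat_power)
  have "0 \<le> e4_shift k" "e4_shift k < 5 ^ k" using s pos by linarith+
  hence "5 ^ k * 0 < 5 ^ k * t" "5 ^ k * t < 5 ^ k * 2" unfolding t[symmetric] using b by linarith+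
  hence "0 < t" "t < 2" by (simp_all add: mult_less_cancel_left zero_less_mult_iff)
  hence "t = 1" by linarith
  thus ?thesis using t by simp
qed

theorem theorem4p5:
  fixes k n :: nat
  assumes "k \<ge> 1"
  shows "[e4 (5 ^ k * n + delta 5 k) = 0] (mod (5 ^ k))"
proof -
  \<comment> \<open>The summand 5^k in \<open>delta_5\<close> moves the index: the progression
    starts at coefficient 1 of \<open>e4_series k\<close>.\<close>
  have "int (5 ^ k * n + delta 5 k) = 5 ^ k * (int n + 1) - e4_shift k"
    using delta_5[OF assms] by (simp add: algebra_simps)
  hence "of_int (e4 (5 ^ k * n + delta 5 k)) = e4_series k $$ (int n + 1)"
    unfolding e4_series_nth e4_coeff[symmetric] by (simp only:)
  also obtain c where "e4_series k $$ (int n + 1) = of_int (5 ^ k * c)"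
    using e4_series_coeffs[OF assms] unfolding coeffs_mult_def by blast
  finally have "e4 (5 ^ k * n + delta 5 k) = 5 ^ k * c" by (simp only: of_int_eq_iff)
  thus ?thesis by (simp add: cong_0_iff)
qed

end
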